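(* Let $q\in C^\infty(\mathbb{R})$ be strictly positive, and let $x(t)=\int_0^t\sqrt{q(u)}\,du$; assume that $x$ maps $\mathbb{R}$ onto $\mathbb{R}$, and let $t(x)$ denote its inverse. Let $p(x)=2\{t,x\}$ for $x\in\mathbb{R}$, i.e. twice the Schwarzian derivative of $t$ with respect to $x$. Suppose there exist real numbers $\lambda>0$, $\Gamma>0$, $a>0$ with $$\lambda\ \ge\ 6\max\left\{\tfrac1a,\Gamma\right\},$$ and that the Fourier transform of $p$ (as a tempered distribution) is a function satisfying $$|\widehat p(\xi)|\le \Gamma e^{-a|\xi|}\quad\text{for all }\xi\in\mathbb{R}.$$ Then there exist functions $p_b\in C^\infty(\mathbb{R})$ and $\sigma_b\in L^2(\mathbb{R})\cap C^\infty(\mathbb{R})$ such that $\widehat{\sigma_b}$ is integrable and supported in $[-\sqrt2\lambda,\sqrt2\lambda]$, $$\sigma_b(x)=S[T\sigma_b](x)+p_b(x)\quad\text{for all }x\in\mathbb{R},$$ $$|\widehat{\sigma_b}(\xi)|\le 2\Gamma\exp\!\left(-\tfrac56 a|\xi|\right)\quad\text{for all }\xi\in\mathbb{R},$$ and $$\|p-p_b\|_{L^\infty(\mathbb{R})}<\frac{24\Gamma}{5a}\exp\!\left(-\tfrac56 a\lambda\right).$$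
   Context: Fourier transform convention: $\widehat f(\xi)=\int_{\mathbb{R}} f(x)e^{-ix\xi}\,dx$, with inverse $f(x)=\frac1{2\pi}\int_{\mathbb{R}}\widehat f(\xi)e^{ix\xi}\,d\xi$. The Schwarzian derivative of a function $f$ with respect to $s$ is $\{f,s\}=\frac{f'''}{f'}-\frac32\left(\frac{f''}{f'}\right)^2$ (derivatives in $s$); equivalently $p(x(t))=\frac{1}{q(t)}\left(\frac54\left(\frac{q'(t)}{q(t)}\right)^2-\frac{q''(t)}{q(t)}\right)$. For a function $f$ whose Fourier transform is integrable and supported in $[-\sqrt2\lambda,\sqrt2\lambda]$, $Tf(x)=\frac1{2\pi}\int_{\mathbb{R}}e^{ix\xi}\frac{\widehat f(\xi)}{4\lambda^2-\xi^2}\,d\xi$ (this agrees with $Tf(x)=\frac1{4\lambda}\int_{\mathbb{R}}\sin(2\lambda|x-y|)f(y)\,dy$ when $f\in L^1$). For $f\in C^1(\mathbb{R})$, $S[f](x)=\frac14(f'(x))^2-4\lambda^2\left(e^{f(x)}-1-f(x)\right)$. *)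

theory Defs
  imports "HOL-Analysis.Analysis"
begin

definition C_inf :: "(real \<Rightarrow> real) \<Rightarrow> bool" where
  "C_inf f \<longleftrightarrow> (\<forall>n x. ((deriv ^^ n) f) differentiable (at x))"

definition schwarzian :: "(real \<Rightarrow> real) \<Rightarrow> real \<Rightarrow> real" where
  "schwarzian f s = (deriv ^^ 3) f s / deriv f s
      - 3 / 2 * ((deriv ^^ 2) f s / deriv f s) ^ 2"

definition schwartz :: "(real \<Rightarrow> real) \<Rightarrow> bool" where
  "schwartz \<phi> \<longleftrightarrow> C_inf \<phi> \<and>
     (\<forall>k n. bounded (range (\<lambda>x. x ^ k * (deriv ^^ n) \<phi> x)))"

definition fourier :: "(real \<Rightarrow> real) \<Rightarrow> real \<Rightarrow> complex" where
  "fourier f \<xi> = (LINT x|lborel. complex_of_real (f x) * cis (- (x * \<xi>)))"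

definition tempered_FT :: "(real \<Rightarrow> real) \<Rightarrow> (real \<Rightarrow> complex) \<Rightarrow> bool" where
  "tempered_FT f h \<longleftrightarrow> (\<forall>\<phi>. schwartz \<phi> \<longrightarrow>
      integrable lborel (\<lambda>x. f x *\<^sub>R fourier \<phi> x) \<and>
      integrable lborel (\<lambda>\<xi>. \<phi> \<xi> *\<^sub>R h \<xi>) \<and>
      (LINT x|lborel. f x *\<^sub>R fourier \<phi> x) = (LINT \<xi>|lborel. \<phi> \<xi> *\<^sub>R h \<xi>))"

text \<open>T f, expressed through fhat = h (real part; it is real for real f).\<close>
definition Top :: "real \<Rightarrow> (real \<Rightarrow> complex) \<Rightarrow> real \<Rightarrow> real" where
  "Top lam h x = Re (complex_of_real (1 / (2 * pi)) *
      (LINT \<xi>|lborel. cis (x * \<xi>) * h \<xi> / complex_of_real (4 * lam ^ 2 - \<xi> ^ 2)))"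

definition Sop :: "real \<Rightarrow> (real \<Rightarrow> real) \<Rightarrow> real \<Rightarrow> real" where
  "Sop lam f x = (1 / 4) * (deriv f x) ^ 2 - 4 * lam ^ 2 * (exp (f x) - 1 - f x)"

end

theory Submission
  imports Defs "HOL-Real_Asymp.Real_Asymp" "HOL-Probability.Characteristic_Functions" "HOL-Probability.Sinc_Integral"
begin

text \<open>
  On the Fourier side the band-limited equation is a fixed point problem
  \<open>h = 1 (W h + g)\<close>, where \<open>1\<close> is the indicator function of \<open>[- \<lambda>, \<lambda>]\<close>, \<open>g\<close> is the Fourier
  transform of \<open>p\<close>, and \<open>W h\<close> is the transform of \<open>S[T \<sigma>]\<close>, a power series in convolution powers of
  \<open>h / (4 \<lambda>\<^sup>2 - \<xi>\<^sup>2)\<close>. For factors supported in \<open>[- \<lambda>, \<lambda>]\<close>, convolution preserves the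
  weight \<open>exp (- a \<bar>\<xi>\<bar>)\<close> at the cost of a factor \<open>\<lambda> / \<pi>\<close> only; since \<open>\<Gamma> \<le> \<lambda> / 6\<close>, this makes
  \<open>W\<close> a contraction by \<open>1 / 2\<close> in the weighted sup norm on the ball of radius \<open>2 \<Gamma>\<close>.
  Then \<open>p - p\<^sub>b\<close> has the transform \<open>W h + g\<close> cut off to \<open>\<bar>\<xi>\<bar> > \<lambda>\<close>, and the part
  \<open>exp (- 5 a \<bar>\<xi>\<bar> / 6)\<close> of the weight is at most \<open>exp (- 5 a \<lambda> / 6)\<close> there.
\<close>

section \<open>Inverse Fourier transforms and convolution\<close>

text \<open>The bound on \<open>p - p_b\<close> is pointwise, but \<open>p\<close> is known only
  through its pairings with test functions. Passing to \<open>p = inv_ft g\<close> at every point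
  takes continuity of \<open>p\<close>, and this is what the construction of \<open>t(x)\<close>
  from \<open>q\<close> provides. Damping by a Gaussian whose width tends to infinity gives the
  inversion of Schwartz functions and the square integrability of \<open>\<sigma>_b\<close>; dually,
  test functions whose transforms concentrate at a point give the inversion of \<open>p\<close>.
  \<open>S\<close> acts on real functions while the iteration runs on complex transforms, so every
  iterate is kept Hermitian, the symmetry that makes its inverse transform real. The cut at
  \<open>lam\<close>, inside the permitted \<open>sqrt 2 * lam\<close>, keeps the denominator
  \<open>4 * lam^2 - \<xi>^2\<close> at or above \<open>3 * lam^2\<close>. The rate 5/6 comes from
  splitting \<open>a\<close>: convolution leaves the full rate \<open>a\<close>, and its last sixth
  makes the tail integrable, with integral 12 / a. With the factor \<open>1 / (2 * pi)\<close> this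
  yields 12 / pi, which is below 24 / 5.\<close>

definition inv_ft :: "(real \<Rightarrow> complex) \<Rightarrow> real \<Rightarrow> complex" where
  "inv_ft u x = (LINT \<xi>|lborel. cis (x * \<xi>) * u \<xi>) / complex_of_real (2 * pi)"

text \<open>The factor \<open>1 / (2 * pi)\<close> makes \<open>inv_ft\<close> turn this convolution
  into a plain product, so iterated convolutions become powers with no constants attached.\<close>

definition conv :: "(real \<Rightarrow> complex) \<Rightarrow> (real \<Rightarrow> complex) \<Rightarrow> real \<Rightarrow> complex" where
  "conv u v \<xi> = (LINT \<eta>|lborel. u (\<xi> - \<eta>) * v \<eta>) / complex_of_real (2 * pi)"

lemma measurable_cis [measurable]: "cis \<in> borel_measurable borel"
  by (intro borel_measurable_continuous_onI continuous_intros)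

lemma has_bochner_integral_exp_abs:
  fixes a :: real
  assumes "a > 0"
  shows "has_bochner_integral lborel (\<lambda>x. exp (- a * \<bar>x\<bar>)) (2 / a)"
proof -
  have "has_bochner_integral lborel (\<lambda>x. indicator {0..} x *\<^sub>R exp (- a * \<bar>x\<bar>)) (1 / a)"
  proof (rule has_bochner_integral_nn_integral)
    have "(\<integral>\<^sup>+x. ennreal (exp (- a * x)) * indicator {0..} x \<partial>lborel) = ennreal (0 - (- 1 / a) * exp (- a * 0))"
    proof (rule nn_integral_FTC_atLeast[where F="\<lambda>x. (- 1 / a) * exp (- a * x)"])
      show "((\<lambda>x. (- 1 / a) * exp (- a * x)) \<longlongrightarrow> 0) at_top"
        using assms by real_asymp
    qed (use assms in \<open>auto intro!: derivative_eq_intros\<close>)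
    then have "(\<integral>\<^sup>+x. ennreal (exp (- a * x)) * indicator {0..} x \<partial>lborel) = ennreal (1 / a)"
      by simp
    also have "(\<integral>\<^sup>+x. ennreal (exp (- a * x)) * indicator {0..} x \<partial>lborel)
      = (\<integral>\<^sup>+x. ennreal (indicator {0..} x *\<^sub>R exp (- a * \<bar>x\<bar>)) \<partial>lborel)"
      by (intro nn_integral_cong) (auto split: split_indicator)
    finally show "(\<integral>\<^sup>+x. ennreal (indicator {0..} x *\<^sub>R exp (- a * \<bar>x\<bar>)) \<partial>lborel) = ennreal (1 / a)" .
  qed (use assms in auto)
  from has_bochner_integral_even_function[OF this] show ?thesis by simp
qed

lemma integrable_bound_exp_abs:
  fixes u :: "real \<Rightarrow> complex"
  assumes "a > 0" "u \<in> borel_measurable borel" "\<And>\<xi>. norm (u \<xi>) \<le> B * exp (- a * \<bar>\<xi>\<bar>)"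
  shows "integrable lborel u"
proof (rule Bochner_Integration.integrable_bound)
  show "integrable lborel (\<lambda>\<xi>. B * exp (- a * \<bar>\<xi>\<bar>))"
    using has_bochner_integral_exp_abs[OF assms(1)] by (intro integrable_mult_right) (auto simp: has_bochner_integral_iff)
  show "u \<in> borel_measurable lborel" using assms(2) by simp
  show "AE x in lborel. norm (u x) \<le> norm (B * exp (- a * \<bar>x\<bar>))"
    using assms(3) by (auto intro: order_trans[OF _ abs_ge_self])
qed

lemma integrable_cis_mult:
  assumes "integrable lborel u" "f \<in> borel_measurable borel"
  shows "integrable lborel (\<lambda>\<xi>. cis (f \<xi>) * u \<xi>)"
  using assms by (intro Bochner_Integration.integrable_bound[OF assms(1)]) (auto simp: norm_mult)

lemma norm_inv_ft_le:
  assumes "integrable lborel u" "integrable lborel w" "\<And>\<xi>. norm (u \<xi>) \<le> w \<xi>"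
  shows "norm (inv_ft u x) \<le> (LINT \<xi>|lborel. w \<xi>) / (2 * pi)"
proof -
  have "norm (LINT \<xi>|lborel. cis (x * \<xi>) * u \<xi>) \<le> (LINT \<xi>|lborel. norm (cis (x * \<xi>) * u \<xi>))"
    by (rule integral_norm_bound)
  also have "\<dots> \<le> (LINT \<xi>|lborel. w \<xi>)"
    using assms by (intro integral_mono) (auto simp: norm_mult)
  finally show ?thesis by (simp add: inv_ft_def norm_divide divide_right_mono norm_mult)
qed

lemma inv_ft_add:
  "integrable lborel u \<Longrightarrow> integrable lborel v \<Longrightarrow> inv_ft (\<lambda>\<xi>. u \<xi> + v \<xi>) x = inv_ft u x + inv_ft v x"
  by (simp add: inv_ft_def ring_distribs add_divide_distrib integrable_cis_mult)

lemma inv_ft_diff: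
  "integrable lborel u \<Longrightarrow> integrable lborel v \<Longrightarrow> inv_ft (\<lambda>\<xi>. u \<xi> - v \<xi>) x = inv_ft u x - inv_ft v x"
  by (simp add: inv_ft_def ring_distribs diff_divide_distrib integrable_cis_mult)

lemma inv_ft_cmult: "inv_ft (\<lambda>\<xi>. c * u \<xi>) x = c * inv_ft u x"
  by (simp add: inv_ft_def mult.left_commute)

text \<open>Substituting \<open>- \<xi>\<close> absorbs the conjugation of the character. This is
  how real values of \<open>inv_ft u\<close> are read off from a symmetry of
  \<open>u\<close>.\<close>

lemma cnj_inv_ft: "cnj (inv_ft u x) = inv_ft (\<lambda>\<xi>. cnj (u (- \<xi>))) x"
proof -
  have "cnj (LINT \<xi>|lborel. cis (x * \<xi>) * u \<xi>) = (LINT \<xi>|lborel. cnj (cis (x * \<xi>) * u \<xi>))"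
    by (simp del: complex_cnj_mult)
  also have "\<dots> = (LINT \<xi>|lborel. cis (x * \<xi>) * cnj (u (- \<xi>)))"
    by (subst lborel_integral_real_affine[where c="-1" and t=0]) (auto simp: cis_cnj)
  finally show ?thesis by (simp add: inv_ft_def)
qed

text \<open>The character has modulus 1, and by translation invariance the inner integral of the
  norm is the same for every shift, so the double integral factors into two finite ones.\<close>

lemma conv_integrable_pair:
  fixes u v :: "real \<Rightarrow> complex"
  assumes "integrable lborel u" "integrable lborel v" "g \<in> borel_measurable borel"
  shows "integrable (lborel \<Otimes>\<^sub>M lborel) (\<lambda>(\<eta>, \<xi>). cis (g \<xi>) * (u (\<xi> - \<eta>) * v \<eta>))"
proof (rule lborel_pair.Fubini_integrable)
  note [measurable] = borel_measurable_integrable[OF assms(1)] borel_measurable_integrable[OF assms(2)] assms(3)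
  show "(\<lambda>(\<eta>, \<xi>). cis (g \<xi>) * (u (\<xi> - \<eta>) * v \<eta>)) \<in> borel_measurable (lborel \<Otimes>\<^sub>M lborel)"
    by measurable
  have i: "integrable lborel (\<lambda>\<xi>. u (\<xi> - \<eta>))" for \<eta>
    using lborel_integrable_real_affine[OF assms(1), of 1 "- \<eta>"] by (simp add: add.commute)
  show "AE x in lborel. integrable lborel (\<lambda>y. case (x, y) of (\<eta>, \<xi>) \<Rightarrow> cis (g \<xi>) * (u (\<xi> - \<eta>) * v \<eta>))"
    using i assms(3) by (intro AE_I2) (auto intro!: integrable_cis_mult)
  have "(LINT \<xi>|lborel. norm (u (\<xi> - \<eta>))) = (LINT \<xi>|lborel. norm (u \<xi>))" for \<eta>
    by (subst lborel_integral_real_affine[where c=1 and t=\<eta>]) auto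
  then show "integrable lborel (\<lambda>x. LINT y|lborel. norm (case (x, y) of (\<eta>, \<xi>) \<Rightarrow> cis (g \<xi>) * (u (\<xi> - \<eta>) * v \<eta>)))"
    using assms(2) by (simp add: norm_mult)
qed

lemma inv_ft_conv:
  fixes u v :: "real \<Rightarrow> complex"
  assumes "integrable lborel u" "integrable lborel v"
  shows "inv_ft (conv u v) x = inv_ft u x * inv_ft v x"
proof -
  have "(LINT \<xi>|lborel. cis (x * \<xi>) * (LINT \<eta>|lborel. u (\<xi> - \<eta>) * v \<eta>))
      = (LINT \<xi>|lborel. LINT \<eta>|lborel. cis (x * \<xi>) * (u (\<xi> - \<eta>) * v \<eta>))"
    by simp
  also have "\<dots> = (LINT \<eta>|lborel. LINT \<xi>|lborel. cis (x * \<xi>) * (u (\<xi> - \<eta>) * v \<eta>))"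
    by (rule lborel_pair.Fubini_integral) (rule conv_integrable_pair[OF assms, of "\<lambda>\<xi>. x * \<xi>", simplified])
  also have "\<dots> = (LINT \<eta>|lborel. (LINT \<xi>|lborel. cis (x * \<xi>) * u \<xi>) * (cis (x * \<eta>) * v \<eta>))"
  proof (rule Bochner_Integration.integral_cong[OF refl])
    fix \<eta>
    \<comment> \<open>The shift by \<open>\<eta>\<close> splits the character multiplicatively and
      frees the argument of \<open>u\<close>.\<close>
    have "(LINT \<xi>|lborel. cis (x * \<xi>) * (u (\<xi> - \<eta>) * v \<eta>))
      = (LINT \<xi>|lborel. (cis (x * \<xi>) * u \<xi>) * (cis (x * \<eta>) * v \<eta>))"
      by (subst lborel_integral_real_affine[where c=1 and t=\<eta>])
         (auto simp: distrib_left cis_mult[symmetric] mult_ac)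
    then show "(LINT \<xi>|lborel. cis (x * \<xi>) * (u (\<xi> - \<eta>) * v \<eta>))
      = (LINT \<xi>|lborel. cis (x * \<xi>) * u \<xi>) * (cis (x * \<eta>) * v \<eta>)" by simp
  qed
  also have "\<dots> = (LINT \<xi>|lborel. cis (x * \<xi>) * u \<xi>) * (LINT \<eta>|lborel. cis (x * \<eta>) * v \<eta>)"
    by simp
  finally have "(LINT \<xi>|lborel. cis (x * \<xi>) * (LINT \<eta>|lborel. u (\<xi> - \<eta>) * v \<eta>))
    = (LINT \<xi>|lborel. cis (x * \<xi>) * u \<xi>) * (LINT \<eta>|lborel. cis (x * \<eta>) * v \<eta>)" .
  then show ?thesis by (simp add: inv_ft_def conv_def)
qed

lemma conv_measurable:
  assumes [measurable]: "u \<in> borel_measurable borel" "v \<in> borel_measurable borel"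
  shows "conv u v \<in> borel_measurable borel"
  unfolding conv_def[abs_def] by measurable

text \<open>Since \<open>\<bar>\<xi>\<bar> \<le> \<bar>\<xi> - \<eta>\<bar> + \<bar>\<eta>\<bar>\<close>, only the length of the support of \<open>v\<close> enters
  and the decay rate is not degraded.\<close>
lemma norm_conv_le:
  fixes a lam :: real
  assumes "a \<ge> 0" "lam > 0" "A \<ge> 0"
    and u: "\<And>\<xi>. norm (u \<xi>) \<le> A * exp (- a * \<bar>\<xi>\<bar>)"
    and v: "\<And>\<xi>. norm (v \<xi>) \<le> B * exp (- a * \<bar>\<xi>\<bar>)"
    and supp: "\<And>\<xi>. \<bar>\<xi>\<bar> > lam \<Longrightarrow> v \<xi> = 0"
  shows "norm (conv u v \<xi>) \<le> lam / pi * A * B * exp (- a * \<bar>\<xi>\<bar>)"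
proof -
  have B: "B \<ge> 0" using order_trans[OF norm_ge_zero v[of 0]] by simp
  let ?w = "\<lambda>\<eta>. indicator {-lam..lam} \<eta> *\<^sub>R (A * B * exp (- a * \<bar>\<xi>\<bar>))"
  have le: "norm (u (\<xi> - \<eta>) * v \<eta>) \<le> ?w \<eta>" for \<eta>
  proof (cases "\<bar>\<eta>\<bar> \<le> lam")
    case True
    have "norm (u (\<xi> - \<eta>) * v \<eta>) \<le> (A * exp (- a * \<bar>\<xi> - \<eta>\<bar>)) * (B * exp (- a * \<bar>\<eta>\<bar>))"
      unfolding norm_mult using assms B by (intro mult_mono u v) auto
    also have "\<dots> = A * B * exp (- a * (\<bar>\<xi> - \<eta>\<bar> + \<bar>\<eta>\<bar>))"
      by (simp add: exp_add ring_distribs exp_minus exp_diff field_simps)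
    also have "\<dots> \<le> A * B * exp (- a * \<bar>\<xi>\<bar>)"
      using assms(1,3) B by (intro mult_left_mono) (auto intro!: mult_left_mono)
    finally show ?thesis using True by (auto simp: indicator_def)
  next
    case False then show ?thesis using supp[of \<eta>] assms(3) B by (simp add: indicator_def)
  qed
  have "norm (LINT \<eta>|lborel. u (\<xi> - \<eta>) * v \<eta>) \<le> (LINT \<eta>|lborel. ?w \<eta>)"
    by (rule order_trans[OF integral_norm_bound integral_mono'[OF _ le]]) (use B assms in auto)
  also have "\<dots> = 2 * lam * (A * B * exp (- a * \<bar>\<xi>\<bar>))"
    using assms(2) by simp
  finally have "norm (LINT \<eta>|lborel. u (\<xi> - \<eta>) * v \<eta>) / (2 * pi) \<le> 2 * lam * (A * B * exp (- a * \<bar>\<xi>\<bar>)) / (2 * pi)"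
    by (intro divide_right_mono) auto
  then show ?thesis
    by (simp add: conv_def norm_divide norm_mult field_simps)
qed

section \<open>Smoothness of inverse transforms from moments\<close>

text \<open>A single term of the exponential series is at most the whole sum.\<close>

lemma power_le_fact_exp: "(x::real) \<ge> 0 \<Longrightarrow> x ^ n \<le> fact n * exp x"
proof -
  assume x: "x \<ge> 0"
  have "(\<Sum>k\<in>{n}. x ^ k /\<^sub>R fact k) \<le> (\<Sum>k. x ^ k /\<^sub>R fact k)"
    using x by (intro sum_le_suminf summable_exp_generic) auto
  then show ?thesis by (simp add: exp_def field_simps)
qed

text \<open>Half of the decay rate absorbs the polynomial and the other half keeps the product
  integrable.\<close>

lemma integrable_moment_exp_abs:
  fixes u :: "real \<Rightarrow> complex"
  assumes "a > 0" "u \<in> borel_measurable borel" "\<And>\<xi>. norm (u \<xi>) \<le> B * exp (- a * \<bar>\<xi>\<bar>)"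
  shows "integrable lborel (\<lambda>\<xi>. of_real \<xi> ^ n * u \<xi>)"
proof (rule integrable_bound_exp_abs[where a="a / 2" and B = "fact n * (2 / a) ^ n * B"])
  have B: "B \<ge> 0" using order_trans[OF norm_ge_zero assms(3)[of 0]] by simp
  fix \<xi>
  have "\<bar>\<xi>\<bar> ^ n = (2 / a) ^ n * (a / 2 * \<bar>\<xi>\<bar>) ^ n"
    using assms(1) by (simp add: power_mult_distrib[symmetric])
  also have "\<dots> \<le> (2 / a) ^ n * (fact n * exp (a / 2 * \<bar>\<xi>\<bar>))"
    using assms(1) by (intro mult_left_mono power_le_fact_exp) auto
  finally have "\<bar>\<xi>\<bar> ^ n * norm (u \<xi>) \<le> ((2 / a) ^ n * (fact n * exp (a / 2 * \<bar>\<xi>\<bar>))) * (B * exp (- a * \<bar>\<xi>\<bar>))"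
    using assms B by (intro mult_mono) auto
  also have "\<dots> = fact n * (2 / a) ^ n * B * (exp (a / 2 * \<bar>\<xi>\<bar>) * exp (- a * \<bar>\<xi>\<bar>))" by simp
  also have "\<dots> = fact n * (2 / a) ^ n * B * exp (- (a / 2) * \<bar>\<xi>\<bar>)"
    by (simp add: exp_add[symmetric])
  finally show "norm (of_real \<xi> ^ n * u \<xi>) \<le> fact n * (2 / a) ^ n * B * exp (- (a / 2) * \<bar>\<xi>\<bar>)"
    by (simp add: norm_mult norm_power)
qed (use assms in auto)

text \<open>After \<open>cis a\<close> is factored out this is the second-order Taylor remainder of
  the exponential on the imaginary axis.\<close>

lemma norm_cis_diff_le: "norm (cis b - cis a - of_real (b - a) * (\<i> * cis a)) \<le> (b - a)\<^sup>2 / 2"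
proof -
  have "cis b - cis a - of_real (b - a) * (\<i> * cis a) = cis a * (cis (b - a) - 1 - \<i> * of_real (b - a))"
    by (simp add: ring_distribs cis_mult mult_ac)
  then have "norm (cis b - cis a - of_real (b - a) * (\<i> * cis a)) = norm (cis (b - a) - 1 - \<i> * of_real (b - a))"
    by (simp add: norm_mult)
  also have "\<dots> \<le> (b - a)\<^sup>2 / 2"
    using iexp_approx1[of "b - a" 1] by (simp add: cis_conv_exp diff_diff_eq power2_eq_square)
  finally show ?thesis .
qed

text \<open>The first-order remainder of the character is at most half the square of
  \<open>(y - x) * \<xi>\<close>; integrated against \<open>u\<close> it costs the second moment,
  which is why that moment is assumed, and it is quadratic in \<open>y - x\<close>. The real part
  appears because \<open>deriv\<close> is applied to real functions in \<open>C_inf\<close>.\<close>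

lemma Re_inv_ft_has_derivative:
  assumes u: "integrable lborel u" "integrable lborel (\<lambda>\<xi>. of_real \<xi> * u \<xi>)"
    "integrable lborel (\<lambda>\<xi>. of_real \<xi> ^ 2 * u \<xi>)"
  shows "((\<lambda>x. Re (inv_ft u x)) has_real_derivative Re (inv_ft (\<lambda>\<xi>. \<i> * of_real \<xi> * u \<xi>) x)) (at x)"
proof -
  define D where "D = inv_ft (\<lambda>\<xi>. \<i> * of_real \<xi> * u \<xi>) x"
  define M where "M = (LINT \<xi>|lborel. norm (of_real \<xi> ^ 2 * u \<xi>) / 2) / (2 * pi)"
  have iu: "integrable lborel (\<lambda>\<xi>. \<i> * of_real \<xi> * u \<xi>)"
    using integrable_mult_right[OF u(2), of \<i>] by (simp add: mult_ac)
  have "norm (inv_ft u y - inv_ft u x - of_real (y - x) * D) \<le> (y - x)\<^sup>2 * M" for y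
  proof -
    let ?g = "\<lambda>\<xi>. (cis (y * \<xi>) - cis (x * \<xi>) - of_real (y * \<xi> - x * \<xi>) * (\<i> * cis (x * \<xi>))) * u \<xi>"
    have g: "?g = (\<lambda>\<xi>. cis (y * \<xi>) * u \<xi> - cis (x * \<xi>) * u \<xi> - of_real (y - x) * (cis (x * \<xi>) * (\<i> * of_real \<xi> * u \<xi>)))"
      by (auto simp: fun_eq_iff algebra_simps)
    have ig: "integrable lborel ?g"
      unfolding g using u iu by (intro Bochner_Integration.integrable_diff integrable_mult_right integrable_cis_mult) auto
    have i: "integrable lborel (\<lambda>\<xi>. cis (z * \<xi>) * u \<xi>)" "integrable lborel (\<lambda>\<xi>. cis (z * \<xi>) * (\<i> * of_real \<xi> * u \<xi>))" for z
      using u iu by (auto intro!: integrable_cis_mult)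
    have "(LINT \<xi>|lborel. ?g \<xi>) = (LINT \<xi>|lborel. cis (y * \<xi>) * u \<xi>) - (LINT \<xi>|lborel. cis (x * \<xi>) * u \<xi>)
        - of_real (y - x) * (LINT \<xi>|lborel. cis (x * \<xi>) * (\<i> * of_real \<xi> * u \<xi>))"
      unfolding g
      by (subst Bochner_Integration.integral_diff, intro Bochner_Integration.integrable_diff i,
          intro integrable_mult_right i, subst Bochner_Integration.integral_diff, intro i, intro i,
          subst integral_mult_right_zero, rule refl)
    then have eq: "inv_ft u y - inv_ft u x - of_real (y - x) * D = (LINT \<xi>|lborel. ?g \<xi>) / of_real (2 * pi)"
      unfolding D_def inv_ft_def by (simp add: diff_divide_distrib)
    have le: "norm (?g \<xi>) \<le> (y - x)\<^sup>2 * (norm (of_real \<xi> ^ 2 * u \<xi>) / 2)" for \<xi>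
    proof -
      have "norm (?g \<xi>) \<le> (y * \<xi> - x * \<xi>)\<^sup>2 / 2 * norm (u \<xi>)"
        unfolding norm_mult by (intro mult_right_mono norm_cis_diff_le) auto
      then show ?thesis
        by (simp add: norm_mult norm_power left_diff_distrib[symmetric] power_mult_distrib)
    qed
    have "norm (inv_ft u y - inv_ft u x - of_real (y - x) * D) = norm (LINT \<xi>|lborel. ?g \<xi>) / (2 * pi)"
      unfolding eq by (simp only: norm_divide norm_of_real) simp
    also have "\<dots> \<le> (LINT \<xi>|lborel. (y - x)\<^sup>2 * (norm (of_real \<xi> ^ 2 * u \<xi>) / 2)) / (2 * pi)"
      by (rule divide_right_mono, rule Bochner_Integration.integral_norm_bound_integral[OF ig _ le])
         (use u(3) in \<open>auto intro!: integrable_mult_right integrable_norm\<close>)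
    also have "\<dots> = (y - x)\<^sup>2 * M" by (simp add: M_def)
    finally show ?thesis .
  qed
  note 1 = this
  have 2: "norm ((Re (inv_ft u y) - Re (inv_ft u x)) / (y - x) - Re D) \<le> \<bar>y - x\<bar> * M" if "y \<noteq> x" for y
  proof -
    have "(Re (inv_ft u y) - Re (inv_ft u x)) / (y - x) - Re D = Re (inv_ft u y - inv_ft u x - of_real (y - x) * D) / (y - x)"
      using that by (simp add: field_simps)
    then have "norm ((Re (inv_ft u y) - Re (inv_ft u x)) / (y - x) - Re D) \<le> (y - x)\<^sup>2 * M / \<bar>y - x\<bar>"
      using order_trans[OF abs_Re_le_cmod 1] by (simp add: divide_right_mono)
    also have "\<dots> = \<bar>y - x\<bar> * M"
    proof -
      have "(y - x)\<^sup>2 * M / \<bar>y - x\<bar> = (\<bar>y - x\<bar> * \<bar>y - x\<bar>) * M / \<bar>y - x\<bar>"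
        by (simp add: power2_eq_square)
      also have "\<dots> = \<bar>y - x\<bar> * M" using that by (simp del: abs_mult_self_eq)
      finally show ?thesis .
    qed
    finally show ?thesis .
  qed
  have "((\<lambda>y. (Re (inv_ft u y) - Re (inv_ft u x)) / (y - x) - Re D) \<longlongrightarrow> 0) (at x)"
  proof (rule Lim_null_comparison)
    show "\<forall>\<^sub>F y in at x. norm ((Re (inv_ft u y) - Re (inv_ft u x)) / (y - x) - Re D) \<le> \<bar>y - x\<bar> * M"
      using 2 by (auto simp: eventually_at_filter)
    show "((\<lambda>y. \<bar>y - x\<bar> * M) \<longlongrightarrow> 0) (at x)"
      by (auto intro!: tendsto_eq_intros)
  qed
  then show ?thesis
    unfolding has_field_derivative_iff D_def[symmetric] by (rule Lim_null[THEN iffD2])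
qed

lemma deriv_Re_inv_ft:
  assumes "\<And>n. integrable lborel (\<lambda>\<xi>. of_real \<xi> ^ n * u \<xi>)"
  shows "deriv (\<lambda>x. Re (inv_ft u x)) = (\<lambda>x. Re (inv_ft (\<lambda>\<xi>. \<i> * of_real \<xi> * u \<xi>) x))"
    using Re_inv_ft_has_derivative[of u] assms[of 0] assms[of 1] assms[of 2] by (intro ext DERIV_imp_deriv) auto

text \<open>Each differentiation multiplies the transform by \<open>\<i> * \<xi>\<close>, and the
  class of functions with all moments integrable is closed under this.\<close>

lemma C_inf_Re_inv_ft:
  assumes "\<And>n. integrable lborel (\<lambda>\<xi>. of_real \<xi> ^ n * u \<xi>)"
  shows "C_inf (\<lambda>x. Re (inv_ft u x))"
proof -
  have "\<exists>v. (deriv ^^ n) (\<lambda>x. Re (inv_ft u x)) = (\<lambda>x. Re (inv_ft v x)) \<and> (\<forall>k. integrable lborel (\<lambda>\<xi>. of_real \<xi> ^ k * v \<xi>))" for n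
  proof (induction n)
    case 0 show ?case using assms by auto
  next
    case (Suc n)
    then obtain v where v: "(deriv ^^ n) (\<lambda>x. Re (inv_ft u x)) = (\<lambda>x. Re (inv_ft v x))"
      "\<And>k. integrable lborel (\<lambda>\<xi>. of_real \<xi> ^ k * v \<xi>)" by blast
    have "integrable lborel (\<lambda>\<xi>. of_real \<xi> ^ k * (\<i> * of_real \<xi> * v \<xi>))" for k
      using integrable_mult_right[OF v(2)[of "Suc k"], of \<i>] by (simp add: mult_ac)
    then show ?case using v deriv_Re_inv_ft[of v] by (intro exI[of _ "\<lambda>\<xi>. \<i> * of_real \<xi> * v \<xi>"]) simp
  qed
  moreover have "(\<lambda>x. Re (inv_ft v x)) differentiable (at x)"
    if "\<forall>k. integrable lborel (\<lambda>\<xi>. of_real \<xi> ^ k * v \<xi>)" for v x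
    using Re_inv_ft_has_derivative[of v x] that[rule_format, of 0] that[rule_format, of 1] that[rule_format, of 2]
    by (auto simp: real_differentiable_def)
  ultimately show ?thesis unfolding C_inf_def by metis
qed

section \<open>Gaussian regularisation\<close>

text \<open>A rescaled normal density with mean \<open>b\<close> and variance
  \<open>1 / s\<close>.\<close>

lemma has_bochner_integral_gauss:
  fixes s b :: real
  assumes "s > 0"
  shows "has_bochner_integral lborel (\<lambda>x. exp (- s * (x - b)\<^sup>2 / 2)) (sqrt (2 * pi / s))"
proof -
  have "has_bochner_integral lborel (\<lambda>x. sqrt (2 * pi / s) * normal_density b (1 / sqrt s) x) (sqrt (2 * pi / s) * 1)"
    using assms by (intro has_bochner_integral_mult_right) (simp add: has_bochner_integral_iff)
  also have "(\<lambda>x. sqrt (2 * pi / s) * normal_density b (1 / sqrt s) x) = (\<lambda>x. exp (- s * (x - b)\<^sup>2 / 2))"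
    using assms by (auto simp: normal_density_def real_sqrt_divide power_divide real_sqrt_mult fun_eq_iff mult_ac)
  finally show ?thesis by simp
qed

text \<open>Rescaling by \<open>sqrt s\<close> reduces this to the characteristic function of the
  standard normal distribution.\<close>

lemma integral_cis_gauss:
  fixes s x :: real
  assumes s: "s > 0"
  shows "(LINT \<xi>|lborel. cis (x * \<xi>) * complex_of_real (exp (- s * \<xi>\<^sup>2 / 2)))
    = complex_of_real (sqrt (2 * pi / s) * exp (- (x\<^sup>2 / (2 * s))))"
proof -
  have "(LINT \<xi>|lborel. cis (x * \<xi>) * complex_of_real (exp (- s * \<xi>\<^sup>2 / 2)))
     = (1 / sqrt s) *\<^sub>R (LINT \<xi>|lborel. cis (x * (\<xi> / sqrt s)) * complex_of_real (exp (- \<xi>\<^sup>2 / 2)))"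
    using s by (subst lborel_integral_real_affine[where c="1 / sqrt s" and t=0]) (auto simp: power_divide)
  also have "(LINT \<xi>|lborel. cis (x * (\<xi> / sqrt s)) * complex_of_real (exp (- \<xi>\<^sup>2 / 2)))
    = (LINT \<xi>|lborel. sqrt (2 * pi) *\<^sub>R (std_normal_density \<xi> *\<^sub>R iexp ((x / sqrt s) * \<xi>)))"
    by (intro Bochner_Integration.integral_cong refl)
       (simp add: std_normal_density_def cis_conv_exp scaleR_conv_of_real mult_ac)
  also have "\<dots> = sqrt (2 * pi) *\<^sub>R char std_normal_distribution (x / sqrt s)"
    unfolding char_def by (subst integral_density) (auto simp del: scaleR_scaleR)
  finally have "(LINT \<xi>|lborel. cis (x * \<xi>) * complex_of_real (exp (- s * \<xi>\<^sup>2 / 2)))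
    = (1 / sqrt s) *\<^sub>R (sqrt (2 * pi) *\<^sub>R char std_normal_distribution (x / sqrt s))" .
  also have "char std_normal_distribution (x / sqrt s) = of_real (exp (- (x\<^sup>2 / (2 * s))))"
    using s by (simp add: char_std_normal_distribution power_divide)
  finally show ?thesis
    by (simp add: scaleR_conv_of_real real_sqrt_divide del: exp_of_real)
qed

text \<open>For \<open>s \<ge> 1\<close> and \<open>\<bar>x - b\<bar> \<ge> \<delta>\<close> the
  kernel is at most \<open>exp (- (\<delta>^2 * (s - 1) / 2))\<close> times the kernel for
  \<open>s = 1\<close>. Integrability against that one Gaussian therefore controls the far part for
  all larger \<open>s\<close>, and \<open>d\<close> may grow at infinity.\<close>

lemma gauss_approx_identity:
  fixes d :: "real \<Rightarrow> complex"
  assumes cont: "isCont d b" and int: "integrable lborel (\<lambda>x. exp (- (x - b)\<^sup>2 / 2) *\<^sub>R d x)"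
  shows "((\<lambda>s. sqrt s *\<^sub>R (LINT x|lborel. exp (- s * (x - b)\<^sup>2 / 2) *\<^sub>R d x)) \<longlongrightarrow> sqrt (2 * pi) *\<^sub>R d b) at_top"
proof (rule tendstoI)
  fix e :: real assume e: "e > 0"
  \<comment> \<open>The near part will cost \<open>\<eta> * sqrt (2 * pi)\<close> and the far part
    less than \<open>\<eta>\<close>; adding 2 instead of 1 in the denominator makes their sum
    strictly smaller than \<open>e\<close>.\<close>
  define \<eta> where "\<eta> = e / (sqrt (2 * pi) + 2)"
  have \<eta>: "\<eta> > 0" "\<eta> * sqrt (2 * pi) + \<eta> < e" using e
  proof -
    have r: "sqrt (2 * pi) + 2 > 0" by (intro add_nonneg_pos) auto
    then show "\<eta> > 0" using e by (simp add: \<eta>_def)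
    have "\<eta> * (sqrt (2 * pi) + 2) = e" using r by (simp add: \<eta>_def)
    then show "\<eta> * sqrt (2 * pi) + \<eta> < e" using \<open>\<eta> > 0\<close> by (simp add: ring_distribs)
  qed
  obtain \<delta> where \<delta>: "\<delta> > 0" "\<And>x. \<bar>x - b\<bar> < \<delta> \<Longrightarrow> norm (d x - d b) < \<eta>"
    using cont \<eta>(1) unfolding continuous_at_eps_delta by (metis dist_norm real_norm_def)
  have g1: "has_bochner_integral lborel (\<lambda>x. exp (- s * (x - b)\<^sup>2 / 2)) (sqrt (2 * pi / s))" if "s > 0" for s
    by (rule has_bochner_integral_gauss) fact
  have gd: "integrable lborel (\<lambda>x. exp (- s * (x - b)\<^sup>2 / 2) *\<^sub>R d b)" if "s > 0" for s
    using g1[OF that] by (auto simp: has_bochner_integral_iff)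
  have int': "integrable lborel (\<lambda>x. exp (- (x - b)\<^sup>2 / 2) *\<^sub>R (d x - d b))"
    using int gd[of 1] by (simp add: scaleR_diff_right)
  define I where "I = (LINT x|lborel. norm (exp (- (x - b)\<^sup>2 / 2) *\<^sub>R (d x - d b)))"
  have "((\<lambda>s. sqrt s * (exp (- (\<delta>\<^sup>2 * (s - 1) / 2)) * I)) \<longlongrightarrow> 0) at_top"
    using \<delta>(1) by real_asymp
  then have "eventually (\<lambda>s. sqrt s * (exp (- (\<delta>\<^sup>2 * (s - 1) / 2)) * I) < \<eta>) at_top"
    using \<eta>(1) by (rule order_tendstoD)
  then show "eventually (\<lambda>s. dist (sqrt s *\<^sub>R (LINT x|lborel. exp (- s * (x - b)\<^sup>2 / 2) *\<^sub>R d x)) (sqrt (2 * pi) *\<^sub>R d b) < e) at_top"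
    using eventually_ge_at_top[of 1]
  proof eventually_elim
    fix s :: real assume 1: "sqrt s * (exp (- (\<delta>\<^sup>2 * (s - 1) / 2)) * I) < \<eta>" and s: "1 \<le> s"
    \<comment> \<open>Only the product with a Gaussian is known to be measurable; multiplying by the
      reciprocal Gaussian recovers the factor.\<close>
    have [measurable]: "(\<lambda>x. d x - d b) \<in> borel_measurable borel"
    proof -
      have "(\<lambda>x. exp ((x - b)\<^sup>2 / 2) *\<^sub>R (exp (- (x - b)\<^sup>2 / 2) *\<^sub>R (d x - d b))) \<in> borel_measurable borel"
        using borel_measurable_integrable[OF int'] by measurable
      then show ?thesis by (simp add: exp_add[symmetric])
    qed
    have le: "norm (exp (- s * (x - b)\<^sup>2 / 2) *\<^sub>R (d x - d b)) \<le>
       \<eta> * exp (- s * (x - b)\<^sup>2 / 2) + exp (- (\<delta>\<^sup>2 * (s - 1) / 2)) * norm (exp (- (x - b)\<^sup>2 / 2) *\<^sub>R (d x - d b))" for x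
    proof (cases "\<bar>x - b\<bar> < \<delta>")
      case True
      have "norm (exp (- s * (x - b)\<^sup>2 / 2) *\<^sub>R (d x - d b)) \<le> exp (- s * (x - b)\<^sup>2 / 2) * \<eta>"
        using \<delta>(2)[OF True] by (simp add: mult_left_mono)
      also have "\<dots> \<le> \<eta> * exp (- s * (x - b)\<^sup>2 / 2) + exp (- (\<delta>\<^sup>2 * (s - 1) / 2)) * norm (exp (- (x - b)\<^sup>2 / 2) *\<^sub>R (d x - d b))"
        by simp
      finally show ?thesis .
    next
      case False
      then have "\<delta>\<^sup>2 \<le> (x - b)\<^sup>2" using \<delta>(1) by (intro abs_le_square_iff[THEN iffD1]) auto
      then have "\<delta>\<^sup>2 * (s - 1) \<le> (x - b)\<^sup>2 * (s - 1)" using s by (intro mult_right_mono) auto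
      then have "- s * (x - b)\<^sup>2 / 2 \<le> - (\<delta>\<^sup>2 * (s - 1) / 2) + (- (x - b)\<^sup>2 / 2)"
        by (simp add: field_simps)
      then have "exp (- s * (x - b)\<^sup>2 / 2) \<le> exp (- (\<delta>\<^sup>2 * (s - 1) / 2)) * exp (- (x - b)\<^sup>2 / 2)"
        unfolding exp_add[symmetric] by (rule exp_le_cancel_iff[THEN iffD2])
      then have "exp (- s * (x - b)\<^sup>2 / 2) * norm (d x - d b) \<le> exp (- (\<delta>\<^sup>2 * (s - 1) / 2)) * exp (- (x - b)\<^sup>2 / 2) * norm (d x - d b)"
        by (rule mult_right_mono) auto
      moreover have "0 \<le> \<eta> * exp (- s * (x - b)\<^sup>2 / 2)" using \<eta>(1) by simp
      ultimately show ?thesis by (simp add: mult.assoc)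
    qed
    have iD1: "integrable lborel (\<lambda>x. \<eta> * exp (- s * (x - b)\<^sup>2 / 2))"
      using g1[of s] s by (intro integrable_mult_right) (auto simp: has_bochner_integral_iff)
    have iD2: "integrable lborel (\<lambda>x. exp (- (\<delta>\<^sup>2 * (s - 1) / 2)) * norm (exp (- (x - b)\<^sup>2 / 2) *\<^sub>R (d x - d b)))"
      by (intro integrable_mult_right integrable_norm int')
    have ints: "integrable lborel (\<lambda>x. exp (- s * (x - b)\<^sup>2 / 2) *\<^sub>R (d x - d b))"
    proof (rule Bochner_Integration.integrable_bound)
      show "integrable lborel (\<lambda>x. \<eta> * exp (- s * (x - b)\<^sup>2 / 2) + exp (- (\<delta>\<^sup>2 * (s - 1) / 2)) * norm (exp (- (x - b)\<^sup>2 / 2) *\<^sub>R (d x - d b)))"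
        by (rule Bochner_Integration.integrable_add[OF iD1 iD2])
      show "AE x in lborel. norm (exp (- s * (x - b)\<^sup>2 / 2) *\<^sub>R (d x - d b)) \<le>
       norm (\<eta> * exp (- s * (x - b)\<^sup>2 / 2) + exp (- (\<delta>\<^sup>2 * (s - 1) / 2)) * norm (exp (- (x - b)\<^sup>2 / 2) *\<^sub>R (d x - d b)))"
        by (intro AE_I2 order_trans[OF le]) simp
    qed measurable
    have "(LINT x|lborel. exp (- s * (x - b)\<^sup>2 / 2) *\<^sub>R d x) =
      (LINT x|lborel. exp (- s * (x - b)\<^sup>2 / 2) *\<^sub>R (d x - d b) + exp (- s * (x - b)\<^sup>2 / 2) *\<^sub>R d b)"
      by (simp add: scaleR_diff_right)
    also have "\<dots> = (LINT x|lborel. exp (- s * (x - b)\<^sup>2 / 2) *\<^sub>R (d x - d b)) + sqrt (2 * pi / s) *\<^sub>R d b"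
      using ints gd[of s] g1[of s] s by (subst Bochner_Integration.integral_add) (auto simp: has_bochner_integral_iff)
    finally have eq: "sqrt s *\<^sub>R (LINT x|lborel. exp (- s * (x - b)\<^sup>2 / 2) *\<^sub>R d x) - sqrt (2 * pi) *\<^sub>R d b
      = sqrt s *\<^sub>R (LINT x|lborel. exp (- s * (x - b)\<^sup>2 / 2) *\<^sub>R (d x - d b))"
      using s by (simp add: scaleR_add_right real_sqrt_divide)
    have "norm (sqrt s *\<^sub>R (LINT x|lborel. exp (- s * (x - b)\<^sup>2 / 2) *\<^sub>R d x) - sqrt (2 * pi) *\<^sub>R d b) \<le> sqrt s * (LINT x|lborel. \<eta> * exp (- s * (x - b)\<^sup>2 / 2) + exp (- (\<delta>\<^sup>2 * (s - 1) / 2)) * norm (exp (- (x - b)\<^sup>2 / 2) *\<^sub>R (d x - d b)))"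
      unfolding eq norm_scaleR using s
        Bochner_Integration.integral_norm_bound_integral[OF ints Bochner_Integration.integrable_add[OF iD1 iD2] le]
      by (intro mult_mono) auto
    also have "\<dots> = sqrt s * (\<eta> * sqrt (2 * pi / s) + exp (- (\<delta>\<^sup>2 * (s - 1) / 2)) * I)"
      using g1[of s] s by (subst Bochner_Integration.integral_add[OF iD1 iD2]) (simp add: has_bochner_integral_iff I_def)
    also have "\<dots> = \<eta> * sqrt (2 * pi) + sqrt s * (exp (- (\<delta>\<^sup>2 * (s - 1) / 2)) * I)"
      using s by (simp add: ring_distribs real_sqrt_divide)
    also have "\<dots> < e" using 1 \<eta>(2) by simp
    finally show "dist (sqrt s *\<^sub>R (LINT x|lborel. exp (- s * (x - b)\<^sup>2 / 2) *\<^sub>R d x)) (sqrt (2 * pi) *\<^sub>R d b) < e"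
      by (simp add: dist_norm)
  qed
qed

lemma integrable_pair_prod:
  fixes u v :: "real \<Rightarrow> complex"
  assumes u: "integrable lborel u" and v: "integrable lborel v" and g: "case_prod g \<in> borel_measurable (borel \<Otimes>\<^sub>M borel)"
  shows "integrable (lborel \<Otimes>\<^sub>M lborel) (\<lambda>(x, y). cis (g x y) * (u x * v y))"
proof (rule lborel_pair.Fubini_integrable)
  note [measurable] = borel_measurable_integrable[OF u] borel_measurable_integrable[OF v] g
  show "(\<lambda>(x, y). cis (g x y) * (u x * v y)) \<in> borel_measurable (lborel \<Otimes>\<^sub>M lborel)"
    by measurable
  have "(\<lambda>y. g x y) \<in> borel_measurable borel" for x by measurable
  then show "AE x in lborel. integrable lborel (\<lambda>y. case (x, y) of (x, y) \<Rightarrow> cis (g x y) * (u x * v y))"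
    using v by (intro AE_I2) (auto intro!: integrable_cis_mult)
  show "integrable lborel (\<lambda>x. LINT y|lborel. norm (case (x, y) of (x, y) \<Rightarrow> cis (g x y) * (u x * v y)))"
    using u by (simp add: norm_mult)
qed

text \<open>The kernel is symmetric in its two variables, so Fubini moves the transform from one
  factor to the other. Inversion and square integrability below are both derived from this
  formula.\<close>

lemma integral_inv_ft_mult:
  assumes u: "integrable lborel u" and v: "integrable lborel v"
  shows "(LINT x|lborel. inv_ft u x * v x) = (LINT \<xi>|lborel. u \<xi> * inv_ft v \<xi>)"
proof -
  have "(LINT x|lborel. LINT \<xi>|lborel. cis (\<xi> * x) * (u \<xi> * v x)) = (LINT \<xi>|lborel. LINT x|lborel. cis (\<xi> * x) * (u \<xi> * v x))"
    by (rule lborel_pair.Fubini_integral) (rule integrable_pair_prod[OF u v], measurable)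
  also have "(\<lambda>\<xi>. LINT x|lborel. cis (\<xi> * x) * (u \<xi> * v x)) = (\<lambda>\<xi>. of_real (2 * pi) * (u \<xi> * inv_ft v \<xi>))"
    by (simp add: inv_ft_def mult.left_commute[of _ "u _"])
  also have "(\<lambda>x. LINT \<xi>|lborel. cis (\<xi> * x) * (u \<xi> * v x)) = (\<lambda>x. of_real (2 * pi) * (inv_ft u x * v x))"
    by (simp add: inv_ft_def mult.assoc[symmetric] mult.commute[of "_::real"])
  finally show ?thesis by simp
qed

lemma norm_inv_ft_le_L1: "integrable lborel u \<Longrightarrow> norm (inv_ft u x) \<le> (LINT \<xi>|lborel. norm (u \<xi>)) / (2 * pi)"
  by (rule norm_inv_ft_le) auto

lemma borel_measurable_inv_ft:
  assumes [measurable]: "u \<in> borel_measurable borel"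
  shows "inv_ft u \<in> borel_measurable borel"
  unfolding inv_ft_def[abs_def] by measurable

lemma integrable_inv_ft_mult:
  assumes u: "integrable lborel u" and v: "integrable lborel v"
  shows "integrable lborel (\<lambda>x. inv_ft u x * v x)"
proof (rule Bochner_Integration.integrable_bound)
  show "integrable lborel (\<lambda>x. (LINT \<xi>|lborel. norm (u \<xi>)) / (2 * pi) * norm (v x))" using v by auto
  show "(\<lambda>x. inv_ft u x * v x) \<in> borel_measurable lborel"
    using borel_measurable_integrable[OF u] borel_measurable_integrable[OF v] borel_measurable_inv_ft[of u] by auto
  show "AE x in lborel. norm (inv_ft u x * v x) \<le> norm ((LINT \<xi>|lborel. norm (u \<xi>)) / (2 * pi) * norm (v x))"
  proof (intro AE_I2)
    fix x
    have "norm (inv_ft u x * v x) \<le> (LINT \<xi>|lborel. norm (u \<xi>)) / (2 * pi) * norm (v x)"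
      unfolding norm_mult by (intro mult_right_mono norm_inv_ft_le_L1[OF u]) simp
    then show "norm (inv_ft u x * v x) \<le> norm ((LINT \<xi>|lborel. norm (u \<xi>)) / (2 * pi) * norm (v x))"
      by simp
  qed
qed

lemma inv_ft_gauss:
  fixes s :: real
  assumes s: "s > 0"
  defines "G \<equiv> \<lambda>x. complex_of_real (exp (- s * x\<^sup>2 / 2))"
  shows "integrable lborel G" "inv_ft G x = of_real (exp (- (x\<^sup>2 / (2 * s))) / sqrt (2 * pi * s))"
proof -
  have "integrable lborel (\<lambda>x. exp (- s * (x - 0)\<^sup>2 / 2))"
    using has_bochner_integral_gauss[OF s, of 0] by (simp add: has_bochner_integral_iff)
  then show "integrable lborel G" unfolding G_def by (intro integrable_of_real) simp
  have "2 * pi = sqrt (2 * pi) * sqrt (2 * pi)" by simp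
  then have "sqrt (2 * pi / s) / (2 * pi) = 1 / sqrt (2 * pi * s)"
    using s by (simp add: real_sqrt_mult real_sqrt_divide divide_simps)
  then have "sqrt (2 * pi / s) * exp (- (x\<^sup>2 / (2 * s))) / (2 * pi) = exp (- (x\<^sup>2 / (2 * s))) / sqrt (2 * pi * s)"
    by (metis (no_types, lifting) times_divide_eq_left mult_1)
  then show "inv_ft G x = of_real (exp (- (x\<^sup>2 / (2 * s))) / sqrt (2 * pi * s))"
    unfolding inv_ft_def G_def integral_cis_gauss[OF s]
    by (simp only: of_real_divide[symmetric])
qed

text \<open>Lets the results on \<open>inv_ft\<close> serve the forward transform as well.\<close>

lemma fourier_eq_inv_ft: "fourier f \<xi> = of_real (2 * pi) * inv_ft (\<lambda>x. of_real (f x)) (- \<xi>)"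
  by (simp add: fourier_def inv_ft_def mult.commute)

text \<open>A Gaussian damping factor makes Fubini applicable.\<close>
theorem inv_ft_fourier:
  assumes cont: "isCont \<phi> \<eta>" and int: "integrable lborel \<phi>" and intF: "integrable lborel (fourier \<phi>)"
  shows "inv_ft (fourier \<phi>) \<eta> = of_real (\<phi> \<eta>)"
proof -
  let ?\<phi> = "\<lambda>x. complex_of_real (\<phi> x)"
  let ?G = "\<lambda>s x. complex_of_real (exp (- (1 / s) * x\<^sup>2 / 2))"
  \<comment> \<open>The limit of \<open>A s\<close> for large \<open>s\<close> is computed twice:
    dominated convergence removes the damping, while the multiplication formula turns
    \<open>A s\<close> into an average of \<open>\<phi>\<close> against a Gaussian concentrating at
    \<open>\<eta>\<close>.\<close>
  define A where "A s = (LINT x|lborel. cis (x * \<eta>) * fourier \<phi> x * ?G s x)" for s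
  have i\<phi>: "integrable lborel ?\<phi>" using int by simp
  have [measurable]: "fourier \<phi> \<in> borel_measurable borel" using borel_measurable_integrable[OF intF] by simp
  have [measurable]: "\<phi> \<in> borel_measurable borel" using borel_measurable_integrable[OF int] by simp
  have "((\<lambda>s. A s) \<longlongrightarrow> (LINT x|lborel. cis (x * \<eta>) * fourier \<phi> x)) at_top"
    unfolding A_def
  proof (rule integral_dominated_convergence_at_top[where w="\<lambda>x. norm (fourier \<phi> x)"])
    show "AE x in lborel. ((\<lambda>s. cis (x * \<eta>) * fourier \<phi> x * ?G s x) \<longlongrightarrow> cis (x * \<eta>) * fourier \<phi> x) at_top"
    proof (intro AE_I2)
      fix x :: real
      have "((\<lambda>s::real. exp (- (1 / s) * x\<^sup>2 / 2)) \<longlongrightarrow> 1) at_top" by real_asymp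
      then have "((\<lambda>s. cis (x * \<eta>) * fourier \<phi> x * ?G s x) \<longlongrightarrow> cis (x * \<eta>) * fourier \<phi> x * of_real 1) at_top"
        by (intro tendsto_intros)
      then show "((\<lambda>s. cis (x * \<eta>) * fourier \<phi> x * ?G s x) \<longlongrightarrow> cis (x * \<eta>) * fourier \<phi> x) at_top" by simp
    qed
    show "\<forall>\<^sub>F s in at_top. AE x in lborel. norm (cis (x * \<eta>) * fourier \<phi> x * ?G s x) \<le> norm (fourier \<phi> x)"
      using eventually_gt_at_top[of 0]
      by eventually_elim (auto simp: norm_mult mult_left_le simp del: exp_of_real of_real_exp)
  qed (use intF in \<open>auto\<close>)
  moreover have "((\<lambda>s. A s) \<longlongrightarrow> of_real (2 * pi * \<phi> \<eta>)) at_top"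
  proof -
    have eq: "A s = sqrt (2 * pi) *\<^sub>R (sqrt s *\<^sub>R (LINT x|lborel. exp (- s * (x - \<eta>)\<^sup>2 / 2) *\<^sub>R ?\<phi> x))" if s: "s > 0" for s
    proof -
      have iG: "integrable lborel (\<lambda>x. cis (- (x * \<eta>)) * ?G s x)"
        using inv_ft_gauss(1)[of "1 / s"] s by (intro integrable_cis_mult) auto
      have "A s = (LINT x|lborel. of_real (2 * pi) * (inv_ft ?\<phi> x * (cis (- (x * \<eta>)) * ?G s x)))"
        unfolding A_def fourier_eq_inv_ft
        by (subst lborel_integral_real_affine[where c="-1" and t=0]) (auto simp: mult_ac)
      also have "\<dots> = of_real (2 * pi) * (LINT x|lborel. ?\<phi> x * inv_ft (\<lambda>x. cis (- (x * \<eta>)) * ?G s x) x)"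
        by (subst integral_mult_right_zero) (simp only: integral_inv_ft_mult[OF i\<phi> iG])
      also have "(\<lambda>x. inv_ft (\<lambda>x. cis (- (x * \<eta>)) * ?G s x) x) = (\<lambda>x. inv_ft (?G s) (x - \<eta>))"
        by (simp add: inv_ft_def mult.assoc[symmetric] cis_mult algebra_simps fun_eq_iff)
      also have "\<dots> = (\<lambda>x. of_real (exp (- s * (x - \<eta>)\<^sup>2 / 2) * (sqrt s / sqrt (2 * pi))))"
        using s by (subst inv_ft_gauss(2)) (auto simp: fun_eq_iff real_sqrt_divide divide_simps)
      also have "of_real (2 * pi) * (LINT x|lborel. ?\<phi> x * of_real (exp (- s * (x - \<eta>)\<^sup>2 / 2) * (sqrt s / sqrt (2 * pi))))
         = of_real (2 * pi) * (LINT x|lborel. of_real (sqrt s / sqrt (2 * pi)) * (exp (- s * (x - \<eta>)\<^sup>2 / 2) *\<^sub>R ?\<phi> x))"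
        by (simp add: scaleR_conv_of_real mult_ac)
      also have "\<dots> = of_real (2 * pi * (sqrt s / sqrt (2 * pi))) * (LINT x|lborel. (exp (- s * (x - \<eta>)\<^sup>2 / 2) *\<^sub>R ?\<phi> x))"
        by (subst integral_mult_right_zero) (simp add: mult_ac)
      also have "2 * pi * (sqrt s / sqrt (2 * pi)) = sqrt (2 * pi) * sqrt s"
      proof -
        have "r * r * (c / r) = r * c" for r c :: real by (cases "r = 0") auto
        from this[of "sqrt (2 * pi)" "sqrt s"] show ?thesis by simp
      qed
      finally show ?thesis by (simp add: scaleR_conv_of_real mult.assoc)
    qed
    have "((\<lambda>s. sqrt (2 * pi) *\<^sub>R (sqrt s *\<^sub>R (LINT x|lborel. exp (- s * (x - \<eta>)\<^sup>2 / 2) *\<^sub>R ?\<phi> x)))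
       \<longlongrightarrow> sqrt (2 * pi) *\<^sub>R (sqrt (2 * pi) *\<^sub>R ?\<phi> \<eta>)) at_top"
    proof (rule tendsto_scaleR[OF tendsto_const gauss_approx_identity])
      show "isCont ?\<phi> \<eta>" using cont by (rule isCont_o2) (auto intro: continuous_intros)
      show "integrable lborel (\<lambda>x. exp (- (x - \<eta>)\<^sup>2 / 2) *\<^sub>R ?\<phi> x)"
        by (rule Bochner_Integration.integrable_bound[OF i\<phi>]) (auto simp: mult_left_le_one_le)
    qed
    also have "sqrt (2 * pi) *\<^sub>R (sqrt (2 * pi) *\<^sub>R ?\<phi> \<eta>) = of_real (2 * pi * \<phi> \<eta>)"
      by (simp add: scaleR_conv_of_real flip: of_real_mult)
    finally show ?thesis
      by (rule Lim_transform_eventually) (use eventually_gt_at_top[of 0] in eventually_elim, simp add: eq)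
  qed
  ultimately have "(LINT x|lborel. cis (x * \<eta>) * fourier \<phi> x) = of_real (2 * pi * \<phi> \<eta>)"
    by (rule tendsto_unique[OF trivial_limit_at_top_linorder])
  then show ?thesis by (simp add: inv_ft_def mult.commute)
qed

section \<open>Tempered Fourier transforms\<close>

lemma schwartz_deriv: "schwartz \<phi> \<Longrightarrow> schwartz (deriv \<phi>)"
  unfolding schwartz_def C_inf_def
proof (intro conjI allI; elim conjE)
  fix n x assume "\<forall>n x. (deriv ^^ n) \<phi> differentiable at x"
  from this[rule_format, of "Suc n" x] show "(deriv ^^ n) (deriv \<phi>) differentiable at x"
    by (simp add: funpow_swap1)
next
  fix k n assume "\<forall>k n. bounded (range (\<lambda>x. x ^ k * (deriv ^^ n) \<phi> x))"
  from this[rule_format, of k "Suc n"] show "bounded (range (\<lambda>x. x ^ k * (deriv ^^ n) (deriv \<phi>) x))"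
    by (simp add: funpow_swap1)
qed

lemma schwartz_DERIV: "schwartz \<phi> \<Longrightarrow> (\<phi> has_real_derivative deriv \<phi> x) (at x)"
  unfolding schwartz_def C_inf_def DERIV_deriv_iff_real_differentiable
  by (metis funpow_0)

lemma schwartz_isCont: "schwartz \<phi> \<Longrightarrow> isCont \<phi> x"
  using schwartz_DERIV DERIV_isCont by blast

lemma schwartz_measurable: "schwartz \<phi> \<Longrightarrow> \<phi> \<in> borel_measurable borel"
  by (intro borel_measurable_continuous_onI continuous_at_imp_continuous_on ballI schwartz_isCont)

text \<open>The seminorms with \<open>k = 0\<close> and \<open>k = 2\<close> add up to an integrable
  majorant.\<close>

lemma schwartz_bound:
  assumes "schwartz \<phi>"
  obtains C where "\<And>x. \<bar>\<phi> x\<bar> \<le> C * inverse (1 + x\<^sup>2)"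
proof -
  have "bounded (range (\<lambda>x. x ^ 0 * (deriv ^^ 0) \<phi> x))" "bounded (range (\<lambda>x. x ^ 2 * (deriv ^^ 0) \<phi> x))"
    using assms unfolding schwartz_def by blast+
  then obtain A B where AB: "\<And>x. \<bar>\<phi> x\<bar> \<le> A" "\<And>x. x\<^sup>2 * \<bar>\<phi> x\<bar> \<le> B"
    unfolding bounded_iff by (auto simp: abs_mult)
  have "\<bar>\<phi> x\<bar> \<le> (A + B) * inverse (1 + x\<^sup>2)" for x
  proof -
    have "(1 + x\<^sup>2) * \<bar>\<phi> x\<bar> \<le> A + B" using AB[of x] by (simp add: ring_distribs)
    moreover have "1 + x\<^sup>2 > 0" by (simp add: add_pos_nonneg)
    ultimately show ?thesis by (simp add: field_simps)
  qed
  then show ?thesis using that by blast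
qed

lemma integrable_inverse_1_plus_square_real: "integrable lborel (\<lambda>x::real. inverse (1 + x\<^sup>2))"
  using integrable_inverse_1_plus_square by (simp add: set_integrable_def einterval_def)

lemma schwartz_integrable: assumes "schwartz \<phi>" shows "integrable lborel \<phi>"
proof -
  obtain C where C: "\<And>x. \<bar>\<phi> x\<bar> \<le> C * inverse (1 + x\<^sup>2)" using schwartz_bound[OF assms] by blast
  have "integrable lborel (\<lambda>x::real. C * inverse (1 + x\<^sup>2))"
    using integrable_inverse_1_plus_square_real by (rule integrable_mult_right)
  then show ?thesis
    by (rule Bochner_Integration.integrable_bound)
       (use schwartz_measurable[OF assms] order_trans[OF C abs_ge_self] in auto)
qed

lemma schwartz_tendsto_0:
  assumes "schwartz \<phi>" shows "(\<phi> \<longlongrightarrow> 0) at_top" "(\<phi> \<longlongrightarrow> 0) at_bot"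
proof -
  obtain C where C: "\<And>x. \<bar>\<phi> x\<bar> \<le> C * inverse (1 + x\<^sup>2)" using schwartz_bound[OF assms] by blast
  have *: "((\<lambda>x::real. C * inverse (1 + x\<^sup>2)) \<longlongrightarrow> 0) at_top" "((\<lambda>x::real. C * inverse (1 + x\<^sup>2)) \<longlongrightarrow> 0) at_bot"
    by real_asymp+
  show "(\<phi> \<longlongrightarrow> 0) at_top" "(\<phi> \<longlongrightarrow> 0) at_bot"
    by (rule Lim_null_comparison[OF always_eventually *(1)] Lim_null_comparison[OF always_eventually *(2)],
        use C in simp)+
qed

text \<open>Integration by parts, carried out as the fundamental theorem on the whole line for the
  product \<open>?F\<close>, whose limits at both ends are 0.\<close>

lemma fourier_deriv:
  assumes "schwartz \<phi>"
  shows "fourier (deriv \<phi>) x = \<i> * of_real x * fourier \<phi> x"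
proof -
  let ?F = "\<lambda>\<xi>. complex_of_real (\<phi> \<xi>) * cis (- (\<xi> * x))"
  let ?f = "\<lambda>\<xi>. cis (- (\<xi> * x)) * complex_of_real (deriv \<phi> \<xi>) - \<i> * of_real x * (cis (- (\<xi> * x)) * complex_of_real (\<phi> \<xi>))"
  have i: "integrable lborel (\<lambda>\<xi>. cis (- (\<xi> * x)) * complex_of_real (deriv \<phi> \<xi>))"
    "integrable lborel (\<lambda>\<xi>. cis (- (\<xi> * x)) * complex_of_real (\<phi> \<xi>))"
    using schwartz_integrable[OF assms] schwartz_integrable[OF schwartz_deriv[OF assms]] by (auto intro!: integrable_cis_mult)
  have d: "(?F has_vector_derivative ?f \<xi>) (at \<xi>)" for \<xi>
    using schwartz_DERIV[OF assms, of \<xi>]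
    by (auto intro!: derivative_eq_intros has_vector_derivative_real_field simp: algebra_simps cis_conv_exp
       has_real_derivative_iff_has_vector_derivative)
  have "(LBINT \<xi>=-\<infinity>..\<infinity>. ?f \<xi>) = 0 - 0"
  proof (rule interval_integral_FTC_integrable)
    show "set_integrable lborel (einterval (- \<infinity>) \<infinity>) ?f"
      using i by (simp add: set_integrable_def einterval_def)
    show "((?F \<circ> real_of_ereal) \<longlongrightarrow> 0) (at_right (-\<infinity>))" "((?F \<circ> real_of_ereal) \<longlongrightarrow> 0) (at_left \<infinity>)"
      unfolding ereal_tendsto_simps
      by (rule tendsto_norm_zero_cancel; use schwartz_tendsto_0[OF assms, THEN tendsto_norm_zero] in \<open>simp add: norm_mult\<close>)+
    show "isCont ?f \<xi>" for \<xi>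
      using schwartz_isCont[OF assms] schwartz_isCont[OF schwartz_deriv[OF assms]]
      unfolding cis_conv_exp by (intro continuous_intros)
  qed (use d in auto)
  then have "(LINT \<xi>|lborel. ?f \<xi>) = 0"
    by (simp add: interval_lebesgue_integral_def einterval_def set_lebesgue_integral_def)
  then show ?thesis using i by (simp add: fourier_def mult.commute[of "cis _"])
qed

text \<open>Two derivatives of \<open>\<phi>\<close> become the factor \<open>- x^2\<close>, so the
  transform is bounded even after multiplication by \<open>1 + x^2\<close>.\<close>

lemma integrable_fourier: assumes "schwartz \<phi>" shows "integrable lborel (fourier \<phi>)"
proof -
  define M where "M \<psi> = (LINT x|lborel. \<bar>\<psi> x\<bar>)" for \<psi> :: "real \<Rightarrow> real"
  have M: "norm (fourier \<psi> x) \<le> M \<psi>" for x \<psi>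
    unfolding fourier_def M_def by (rule order_trans[OF integral_norm_bound]) (simp add: norm_mult)
  have F2: "fourier (deriv (deriv \<phi>)) x = - (of_real x)\<^sup>2 * fourier \<phi> x" for x
    by (simp add: fourier_deriv[OF assms] fourier_deriv[OF schwartz_deriv[OF assms]] power2_eq_square algebra_simps)
  have "norm (fourier \<phi> x) \<le> (M \<phi> + M (deriv (deriv \<phi>))) * inverse (1 + x\<^sup>2)" for x
  proof -
    have "x\<^sup>2 * norm (fourier \<phi> x) \<le> M (deriv (deriv \<phi>))"
      using M[of "deriv (deriv \<phi>)" x] unfolding F2 by (simp add: norm_mult norm_power)
    then have "(1 + x\<^sup>2) * norm (fourier \<phi> x) \<le> M \<phi> + M (deriv (deriv \<phi>))"
      using M[of \<phi> x] by (simp add: ring_distribs)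
    moreover have "1 + x\<^sup>2 > 0" by (simp add: add_pos_nonneg)
    ultimately show ?thesis by (simp add: field_simps)
  qed
  note 1 = this
  have [measurable]: "\<phi> \<in> borel_measurable borel" by (rule schwartz_measurable[OF assms])
  show ?thesis
  proof (rule Bochner_Integration.integrable_bound)
    show "integrable lborel (\<lambda>x. (M \<phi> + M (deriv (deriv \<phi>))) * inverse (1 + x\<^sup>2))"
      using integrable_inverse_1_plus_square_real by (rule integrable_mult_right)
    show "fourier \<phi> \<in> borel_measurable lborel" unfolding fourier_def[abs_def] by measurable
    show "AE x in lborel. norm (fourier \<phi> x) \<le> norm ((M \<phi> + M (deriv (deriv \<phi>))) * inverse (1 + x\<^sup>2))"
      by (intro AE_I2 order_trans[OF 1]) simp
  qed
qed

text \<open>The multiplication formula moves \<open>inv_ft\<close> onto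
  \<open>fourier \<phi>\<close>, where inversion returns \<open>\<phi>\<close>. Hence
  \<open>inv_ft h\<close> has the tempered transform \<open>h\<close>, which serves both for
  \<open>\<sigma>_b\<close> and for comparing \<open>p\<close> with \<open>inv_ft g\<close>.\<close>

lemma integral_inv_ft_fourier:
  assumes h: "integrable lborel h" and "schwartz \<phi>"
  shows "integrable lborel (\<lambda>x. inv_ft h x * fourier \<phi> x)"
    "(LINT x|lborel. inv_ft h x * fourier \<phi> x) = (LINT \<xi>|lborel. \<phi> \<xi> *\<^sub>R h \<xi>)"
proof -
  note F = integrable_fourier[OF assms(2)]
  show "integrable lborel (\<lambda>x. inv_ft h x * fourier \<phi> x)" by (rule integrable_inv_ft_mult[OF h F])
  have "(LINT x|lborel. inv_ft h x * fourier \<phi> x) = (LINT \<xi>|lborel. h \<xi> * inv_ft (fourier \<phi>) \<xi>)"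
    by (rule integral_inv_ft_mult[OF h F])
  also have "\<dots> = (LINT \<xi>|lborel. \<phi> \<xi> *\<^sub>R h \<xi>)"
    by (simp add: inv_ft_fourier[OF schwartz_isCont schwartz_integrable F] assms(2) scaleR_conv_of_real mult.commute)
  finally show "(LINT x|lborel. inv_ft h x * fourier \<phi> x) = (LINT \<xi>|lborel. \<phi> \<xi> *\<^sub>R h \<xi>)" .
qed

lemma integrable_schwartz_scaleR:
  fixes h :: "real \<Rightarrow> complex"
  assumes h: "integrable lborel h" and "schwartz \<phi>"
  shows "integrable lborel (\<lambda>\<xi>. \<phi> \<xi> *\<^sub>R h \<xi>)"
proof -
  have "bounded (range (\<lambda>x. x ^ 0 * (deriv ^^ 0) \<phi> x))"
    using assms unfolding schwartz_def by blast
  then obtain A where A: "\<And>x. \<bar>\<phi> x\<bar> \<le> A" unfolding bounded_iff by auto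
  show ?thesis
  proof (rule Bochner_Integration.integrable_bound)
    show "integrable lborel (\<lambda>\<xi>. A * norm (h \<xi>))" using h by auto
    show "(\<lambda>\<xi>. \<phi> \<xi> *\<^sub>R h \<xi>) \<in> borel_measurable lborel"
      using schwartz_measurable[OF assms(2)] borel_measurable_integrable[OF h] by auto
    show "AE \<xi> in lborel. norm (\<phi> \<xi> *\<^sub>R h \<xi>) \<le> norm (A * norm (h \<xi>))"
      using A by (intro AE_I2) (auto intro!: mult_right_mono order_trans[OF A abs_ge_self] simp: abs_mult)
  qed
qed

lemma tempered_FT_inv_ft:
  assumes h: "integrable lborel h" and real: "\<And>x. inv_ft h x = of_real (f x)"
  shows "tempered_FT f h"
  unfolding tempered_FT_def
  using integral_inv_ft_fourier[OF h] integrable_schwartz_scaleR[OF h]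
  by (simp add: real scaleR_conv_of_real)

section \<open>Square integrability of an inverse transform\<close>

text \<open>Takes the place of Plancherel. Since \<open>f\<close> is real, its square is
  \<open>inv_ft h\<close> times itself without conjugation. With Gaussian damping the multiplication
  formula rewrites the integral as a pairing of the integrable \<open>h\<close> with a function
  bounded independently of the width; Fatou's lemma then removes the damping.\<close>

lemma integrable_inv_ft_square:
  fixes f :: "real \<Rightarrow> real"
  assumes h: "integrable lborel h" and B: "\<And>\<xi>. norm (h \<xi>) \<le> B" and real: "\<And>x. inv_ft h x = of_real (f x)"
  shows "integrable lborel (\<lambda>x. (f x)\<^sup>2)"
proof -
  let ?G = "\<lambda>s x. exp (- (1 / s) * x\<^sup>2 / 2)"
  define H where "H = (LINT \<xi>|lborel. norm (h \<xi>))"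
  have [measurable]: "f \<in> borel_measurable borel"
  proof -
    have "f = (\<lambda>x. Re (inv_ft h x))" by (simp add: real)
    also have "\<dots> \<in> borel_measurable borel"
      using borel_measurable_inv_ft[of h] borel_measurable_integrable[OF h] by simp
    finally show ?thesis .
  qed
  have le: "integrable lborel (\<lambda>x. (f x)\<^sup>2 * ?G s x)" "(LINT x|lborel. (f x)\<^sup>2 * ?G s x) \<le> H * (B / (2 * pi))"
    if s: "s > 0" for s
  proof -
    let ?Gc = "\<lambda>x. complex_of_real (?G s x)"
    have s': "1 / s > 0" using s by simp
    have iG: "integrable lborel ?Gc" using inv_ft_gauss(1)[OF s'] by simp
    have ifG: "integrable lborel (\<lambda>x. inv_ft h x * ?Gc x)" by (rule integrable_inv_ft_mult[OF h iG])
    have ifG2: "integrable lborel (\<lambda>x. inv_ft h x * (inv_ft h x * ?Gc x))" by (rule integrable_inv_ft_mult[OF h ifG])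
    have Re: "Re (inv_ft h x * (inv_ft h x * ?Gc x)) = (f x)\<^sup>2 * ?G s x" for x
      by (simp add: real power2_eq_square del: exp_of_real of_real_exp)
    show "integrable lborel (\<lambda>x. (f x)\<^sup>2 * ?G s x)"
      using integrable_Re[OF ifG2] unfolding Re .
    \<comment> \<open>The transform of the damped function is, up to \<open>1 / (2 * pi)\<close> and
      a reflection, \<open>h\<close> averaged against a Gaussian of total mass 1, so the bound
      \<open>B\<close> passes to it whatever \<open>s\<close> is.\<close>
    have bd: "norm (inv_ft (\<lambda>x. inv_ft h x * ?Gc x) \<xi>) \<le> B / (2 * pi)" for \<xi>
    proof -
      have iG': "integrable lborel (\<lambda>x. cis (\<xi> * x) * ?Gc x)" using iG by (intro integrable_cis_mult) auto
      have "(LINT x|lborel. cis (\<xi> * x) * (inv_ft h x * ?Gc x)) = (LINT x|lborel. inv_ft h x * (cis (\<xi> * x) * ?Gc x))"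
        by (simp add: mult_ac)
      also have "\<dots> = (LINT \<eta>|lborel. h \<eta> * inv_ft (\<lambda>x. cis (\<xi> * x) * ?Gc x) \<eta>)"
        by (rule integral_inv_ft_mult[OF h iG'])
      also have "(\<lambda>\<eta>. inv_ft (\<lambda>x. cis (\<xi> * x) * ?Gc x) \<eta>) = (\<lambda>\<eta>. inv_ft ?Gc (\<eta> - (- \<xi>)))"
        by (simp add: inv_ft_def mult.assoc[symmetric] cis_mult algebra_simps fun_eq_iff)
      also have "\<dots> = (\<lambda>\<eta>. of_real (exp (- s * (\<eta> - (- \<xi>))\<^sup>2 / 2) / sqrt (2 * pi / s)))"
        using inv_ft_gauss(2)[OF s'] s by (simp add: mult.commute)
      finally have eq: "(LINT x|lborel. cis (\<xi> * x) * (inv_ft h x * ?Gc x))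
         = (LINT \<eta>|lborel. h \<eta> * of_real (exp (- s * (\<eta> - (- \<xi>))\<^sup>2 / 2) / sqrt (2 * pi / s)))" .
      have g: "has_bochner_integral lborel (\<lambda>\<eta>. B * (exp (- s * (\<eta> - (- \<xi>))\<^sup>2 / 2) / sqrt (2 * pi / s))) (B * (sqrt (2 * pi / s) / sqrt (2 * pi / s)))"
        by (intro has_bochner_integral_mult_right has_bochner_integral_divide_zero has_bochner_integral_gauss s)
      have "norm (LINT x|lborel. cis (\<xi> * x) * (inv_ft h x * ?Gc x)) \<le> (LINT \<eta>|lborel. B * (exp (- s * (\<eta> - (- \<xi>))\<^sup>2 / 2) / sqrt (2 * pi / s)))"
        unfolding eq
      proof (rule order_trans[OF integral_norm_bound integral_mono'])
        show "integrable lborel (\<lambda>\<eta>. B * (exp (- s * (\<eta> - (- \<xi>))\<^sup>2 / 2) / sqrt (2 * pi / s)))"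
          using g by (simp add: has_bochner_integral_iff)
        show "norm (h \<eta> * of_real (exp (- s * (\<eta> - (- \<xi>))\<^sup>2 / 2) / sqrt (2 * pi / s))) \<le> B * (exp (- s * (\<eta> - (- \<xi>))\<^sup>2 / 2) / sqrt (2 * pi / s))" for \<eta>
          unfolding norm_mult norm_of_real using B[of \<eta>] s by (intro mult_mono) (auto intro: order_trans[OF norm_ge_zero])
        show "0 \<le> B * (exp (- s * (\<eta> - (- \<xi>))\<^sup>2 / 2) / sqrt (2 * pi / s))" for \<eta>
          using order_trans[OF norm_ge_zero B] s by simp
      qed
      also have "\<dots> = B" using g s by (simp add: has_bochner_integral_iff)
      finally have "norm (LINT x|lborel. cis (\<xi> * x) * (inv_ft h x * ?Gc x)) \<le> B" .
      then show ?thesis by (simp only: inv_ft_def norm_divide norm_of_real) (simp add: divide_right_mono)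
    qed
    have "(LINT x|lborel. (f x)\<^sup>2 * ?G s x) = (LINT x|lborel. Re (inv_ft h x * (inv_ft h x * ?Gc x)))"
      by (simp only: Re)
    also have "\<dots> = Re (LINT x|lborel. inv_ft h x * (inv_ft h x * ?Gc x))"
      by (rule integral_Re[OF ifG2])
    also have "\<dots> \<le> norm (LINT x|lborel. inv_ft h x * (inv_ft h x * ?Gc x))" by (rule complex_Re_le_cmod)
    also have "(LINT x|lborel. inv_ft h x * (inv_ft h x * ?Gc x)) = (LINT \<xi>|lborel. h \<xi> * inv_ft (\<lambda>x. inv_ft h x * ?Gc x) \<xi>)"
      by (rule integral_inv_ft_mult[OF h ifG])
    also have "norm \<dots> \<le> (LINT \<xi>|lborel. norm (h \<xi>) * (B / (2 * pi)))"
    proof (rule order_trans[OF integral_norm_bound integral_mono'])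
      show "integrable lborel (\<lambda>\<xi>. norm (h \<xi>) * (B / (2 * pi)))" using h by auto
      show "norm (h \<xi> * inv_ft (\<lambda>x. inv_ft h x * ?Gc x) \<xi>) \<le> norm (h \<xi>) * (B / (2 * pi))" for \<xi>
        unfolding norm_mult by (intro mult_left_mono bd) auto
      show "0 \<le> norm (h \<xi>) * (B / (2 * pi))" for \<xi>
        using order_trans[OF norm_ge_zero B] by simp
    qed
    also have "\<dots> = H * (B / (2 * pi))" unfolding H_def by (rule integral_mult_left_zero)
    finally show "(LINT x|lborel. (f x)\<^sup>2 * ?G s x) \<le> H * (B / (2 * pi))" .
  qed
  show ?thesis
  proof (rule integrableI_bounded)
    \<comment> \<open>The widths \<open>Suc n\<close> are positive, so the uniform bound applies to
      every term of the sequence used for Fatou.\<close>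
    have "(\<integral>\<^sup>+x. ennreal (norm ((f x)\<^sup>2)) \<partial>lborel) = (\<integral>\<^sup>+x. liminf (\<lambda>n. ennreal ((f x)\<^sup>2 * ?G (real (Suc n)) x)) \<partial>lborel)"
    proof (rule nn_integral_cong)
      fix x
      have "(\<lambda>n. ?G (real (Suc n)) x) \<longlonglongrightarrow> 1" by real_asymp
      from tendsto_mult_left[OF this, of "(f x)\<^sup>2"] have "(\<lambda>n. ennreal ((f x)\<^sup>2 * ?G (real (Suc n)) x)) \<longlonglongrightarrow> ennreal ((f x)\<^sup>2)"
        by (intro tendsto_ennrealI) simp
      from lim_imp_Liminf[OF trivial_limit_sequentially this] show "ennreal (norm ((f x)\<^sup>2)) = liminf (\<lambda>n. ennreal ((f x)\<^sup>2 * ?G (real (Suc n)) x))"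
        by simp
    qed
    also have "\<dots> \<le> liminf (\<lambda>n. \<integral>\<^sup>+x. ennreal ((f x)\<^sup>2 * ?G (real (Suc n)) x) \<partial>lborel)"
      by (rule nn_integral_liminf) measurable
    also have "\<dots> \<le> liminf (\<lambda>n::nat. ennreal (H * (B / (2 * pi))))"
    proof (intro Liminf_mono always_eventually allI)
      fix n
      have "(\<integral>\<^sup>+x. ennreal ((f x)\<^sup>2 * ?G (real (Suc n)) x) \<partial>lborel) = ennreal (LINT x|lborel. (f x)\<^sup>2 * ?G (real (Suc n)) x)"
        using le(1)[of "real (Suc n)"] by (intro nn_integral_eq_integral) auto
      then show "(\<integral>\<^sup>+x. ennreal ((f x)\<^sup>2 * ?G (real (Suc n)) x) \<partial>lborel) \<le> ennreal (H * (B / (2 * pi)))"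
        using le(2)[of "real (Suc n)"] by (simp add: ennreal_leI del: of_nat_Suc)
    qed
    also have "\<dots> < \<infinity>" by (simp add: Liminf_const)
    finally show "(\<integral>\<^sup>+x. ennreal (norm ((f x)\<^sup>2)) \<partial>lborel) < \<infinity>" .
  qed measurable
qed

section \<open>Schwartz functions of Gaussian type\<close>

text \<open>A class closed under differentiation that contains the modulated Gaussians used as test
  functions. The free phase \<open>\<theta>\<close> lets sines occur as shifted cosines, so one kind
  of generator is enough.\<close>

inductive gauss_trig :: "real \<Rightarrow> real \<Rightarrow> (real \<Rightarrow> real) \<Rightarrow> bool" for b c where
  monomial: "gauss_trig b c (\<lambda>x. x ^ m * cos (b * x + \<theta>) * exp (- c * x\<^sup>2 / 2))"
| add: "gauss_trig b c f \<Longrightarrow> gauss_trig b c g \<Longrightarrow> gauss_trig b c (\<lambda>x. f x + g x)"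
| scale: "gauss_trig b c f \<Longrightarrow> gauss_trig b c (\<lambda>x. k * f x)"

lemma gauss_trig_deriv:
  assumes "gauss_trig b c f"
  shows "\<exists>f'. gauss_trig b c f' \<and> (\<forall>x. (f has_real_derivative f' x) (at x))"
  using assms
proof induction
  case (monomial m \<theta>)
  let ?M = "\<lambda>m \<theta> x. x ^ m * cos (b * x + \<theta>) * exp (- c * x\<^sup>2 / 2)"
  \<comment> \<open>The three terms differentiate the power, the cosine and the Gaussian. For
    \<open>m = 0\<close> the truncated exponent \<open>m - 1\<close> is harmless because its
    coefficient \<open>real m\<close> is 0.\<close>
  let ?f' = "\<lambda>x. (real m * ?M (m - 1) \<theta> x + (- b) * ?M m (\<theta> - pi / 2) x) + (- c) * ?M (Suc m) \<theta> x"
  have "gauss_trig b c ?f'"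
    by (intro gauss_trig.add gauss_trig.scale gauss_trig.monomial)
  moreover have "(?M m \<theta> has_real_derivative ?f' x) (at x)" for x
  proof -
    have "cos (b * x + (\<theta> - pi / 2)) = sin (b * x + \<theta>)"
      by (metis add_diff_eq cos_diff cos_pi_half mult_1_right mult_zero_right sin_pi_half add.left_neutral)
    then show ?thesis
      by (auto intro!: derivative_eq_intros simp: algebra_simps)
  qed
  ultimately show ?case by blast
next
  case (add f g)
  then obtain f' g' where "gauss_trig b c f'" "\<forall>x. (f has_real_derivative f' x) (at x)"
    "gauss_trig b c g'" "\<forall>x. (g has_real_derivative g' x) (at x)" by blast
  then show ?case
    by (intro exI[of _ "\<lambda>x. f' x + g' x"]) (auto intro!: gauss_trig.add derivative_eq_intros)
next
  case (scale f k)
  then obtain f' where "gauss_trig b c f'" "\<forall>x. (f has_real_derivative f' x) (at x)" by blast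
  then show ?case
    by (intro exI[of _ "\<lambda>x. k * f' x"]) (auto intro!: gauss_trig.scale derivative_eq_intros)
qed

lemma gauss_trig_bounded:
  assumes "gauss_trig b c f" "c > 0"
  shows "\<exists>C. \<forall>x. \<bar>x ^ k * f x\<bar> \<le> C"
  using assms(1)
proof induction
  case (monomial m \<theta>)
  have "\<bar>x ^ k * (x ^ m * cos (b * x + \<theta>) * exp (- c * x\<^sup>2 / 2))\<bar> \<le> 1 + (2 / c) ^ (k + m) * fact (k + m)" for x
  proof -
    let ?n = "k + m" and ?E = "exp (- c * x\<^sup>2 / 2)"
    \<comment> \<open>Passing to powers of \<open>x^2\<close> allows
      \<open>power_le_fact_exp\<close> to be applied at \<open>c * x^2 / 2\<close>, the exponent of
      the Gaussian itself.\<close>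
    have "\<bar>x\<bar> ^ ?n \<le> 1 + (x\<^sup>2) ^ ?n"
    proof (cases "\<bar>x\<bar> \<le> 1")
      case True
      then have "\<bar>x\<bar> ^ ?n \<le> 1" by (intro power_le_one) auto
      then show ?thesis by (simp add: add_increasing2)
    next
      case False
      then have "\<bar>x\<bar> ^ ?n \<le> (\<bar>x\<bar> ^ ?n)\<^sup>2" by (intro self_le_power) auto
      also have "(\<bar>x\<bar> ^ ?n)\<^sup>2 = (\<bar>x\<bar>\<^sup>2) ^ ?n" by (metis power_mult mult.commute)
      finally show ?thesis unfolding power2_abs by linarith
    qed
    also have "(x\<^sup>2) ^ ?n = (2 / c) ^ ?n * (c * x\<^sup>2 / 2) ^ ?n"
      using assms(2) by (simp add: power_mult_distrib[symmetric])
    also have "\<dots> \<le> (2 / c) ^ ?n * (fact ?n * exp (c * x\<^sup>2 / 2))"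
      using assms(2) by (intro mult_left_mono power_le_fact_exp) auto
    finally have "\<bar>x\<bar> ^ ?n * ?E \<le> (1 + (2 / c) ^ ?n * (fact ?n * exp (c * x\<^sup>2 / 2))) * ?E"
      by (intro mult_right_mono) auto
    also have "\<dots> = ?E + (2 / c) ^ ?n * fact ?n * (exp (c * x\<^sup>2 / 2) * ?E)"
      by (simp add: ring_distribs)
    also have "exp (c * x\<^sup>2 / 2) * ?E = 1" by (simp add: exp_add[symmetric])
    finally have "\<bar>x\<bar> ^ ?n * ?E \<le> 1 + (2 / c) ^ ?n * fact ?n"
      using assms(2) by (simp add: order_trans)
    moreover have "\<bar>x ^ k * (x ^ m * cos (b * x + \<theta>) * ?E)\<bar> = (\<bar>x\<bar> ^ ?n * ?E) * \<bar>cos (b * x + \<theta>)\<bar>"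
      by (simp add: abs_mult power_abs power_add)
    moreover have "\<dots> \<le> \<bar>x\<bar> ^ ?n * ?E * 1" by (intro mult_left_mono) auto
    ultimately show ?thesis by linarith
  qed
  then show ?case by blast
next
  case (add f g)
  then obtain A B where "\<forall>x. \<bar>x ^ k * f x\<bar> \<le> A" "\<forall>x. \<bar>x ^ k * g x\<bar> \<le> B" by blast
  then have "\<bar>x ^ k * (f x + g x)\<bar> \<le> A + B" for x
    by (simp add: ring_distribs) (metis abs_triangle_ineq add_mono order_trans)
  then show ?case by blast
next
  case (scale f l)
  then obtain A where "\<forall>x. \<bar>x ^ k * f x\<bar> \<le> A" by blast
  then have "\<bar>l\<bar> * \<bar>x ^ k * f x\<bar> \<le> \<bar>l\<bar> * A" for x by (intro mult_left_mono) auto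
  then have "\<bar>x ^ k * (l * f x)\<bar> \<le> \<bar>l\<bar> * A" for x by (simp add: abs_mult mult_ac)
  then show ?case by blast
qed

lemma schwartz_gauss_trig:
  assumes f: "gauss_trig b c f" and c: "c > 0"
  shows "schwartz f"
proof -
  have *: "gauss_trig b c ((deriv ^^ n) f)" for n
  proof (induction n)
    case (Suc n)
    then obtain f' where "gauss_trig b c f'" "\<forall>x. ((deriv ^^ n) f has_real_derivative f' x) (at x)"
      using gauss_trig_deriv by blast
    moreover from this have "deriv ((deriv ^^ n) f) = f'" by (auto intro!: DERIV_imp_deriv)
    ultimately show ?case by simp
  qed (simp add: f)
  show ?thesis
    unfolding schwartz_def C_inf_def bounded_iff
    using gauss_trig_deriv[OF *] gauss_trig_bounded[OF * c] by (auto simp: real_differentiable_def) metis+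
qed

section \<open>Pointwise inversion of a tempered transform\<close>

lemma isCont_inv_ft:
  assumes "integrable lborel u" shows "isCont (inv_ft u) x"
  unfolding continuous_at_sequentially
proof safe
  fix X assume X: "X \<longlonglongrightarrow> x"
  have [measurable]: "u \<in> borel_measurable borel" using borel_measurable_integrable[OF assms] by simp
  have "(\<lambda>n. (LINT \<xi>|lborel. cis (X n * \<xi>) * u \<xi>)) \<longlonglongrightarrow> (LINT \<xi>|lborel. cis (x * \<xi>) * u \<xi>)"
    by (rule integral_dominated_convergence[where w="\<lambda>\<xi>. norm (u \<xi>)"])
       (use assms in \<open>auto simp: norm_mult cis_conv_exp intro!: tendsto_intros X\<close>)
  then show "(inv_ft u \<circ> X) \<longlonglongrightarrow> inv_ft u x"
    unfolding inv_ft_def comp_def by (intro tendsto_intros) auto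
qed

text \<open>The difference \<open>d\<close> of \<open>p\<close> and \<open>inv_ft g\<close>
  integrates to 0 against the transform of every Schwartz function. Suitable test functions have as
  transforms Gaussians centred at \<open>b\<close> of any width, and their concentration picks out
  \<open>d b\<close>, by continuity at \<open>b\<close>.\<close>

theorem tempered_FT_inversion:
  assumes FT: "tempered_FT p g" and g: "integrable lborel g" and cont: "isCont p b"
  shows "inv_ft g b = of_real (p b)"
proof -
  define d where "d x = of_real (p x) - inv_ft g x" for x
  have d: "integrable lborel (\<lambda>x. d x * fourier \<phi> x) \<and> (LINT x|lborel. d x * fourier \<phi> x) = 0" if "schwartz \<phi>" for \<phi>
    using FT[unfolded tempered_FT_def, rule_format, OF that] integral_inv_ft_fourier[OF g that]
    by (simp add: d_def left_diff_distrib scaleR_conv_of_real)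
  have G: "integrable lborel (\<lambda>x. exp (- s * (x - b)\<^sup>2 / 2) *\<^sub>R d x)"
    "(LINT x|lborel. exp (- s * (x - b)\<^sup>2 / 2) *\<^sub>R d x) = 0" if s: "s > 0" for s
  proof -
    have s': "1 / s > 0" using s by simp
    \<comment> \<open>Test functions are real, so the Gaussian modulated by
      \<open>cis (b * x)\<close> is assembled from its cosine part (phase 0) and its sine part
      (phase \<open>- pi / 2\<close>). Variance \<open>s\<close> here becomes variance
      \<open>1 / s\<close> after the transform.\<close>
    define \<phi> where "\<phi> \<theta> x = x ^ 0 * cos (b * x + \<theta>) * exp (- (1 / s) * x\<^sup>2 / 2)" for \<theta> x :: real
    have \<phi>: "schwartz (\<phi> \<theta>)" for \<theta>
      unfolding \<phi>_def[abs_def] by (rule schwartz_gauss_trig[OF gauss_trig.monomial s'])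
    let ?G = "\<lambda>x. complex_of_real (exp (- (1 / s) * x\<^sup>2 / 2))"
    have i: "integrable lborel (\<lambda>\<xi>. complex_of_real (\<phi> \<theta> \<xi>) * cis (- (\<xi> * x)))" for \<theta> x
      using schwartz_integrable[OF \<phi>[of \<theta>]] integrable_cis_mult[of "\<lambda>\<xi>. complex_of_real (\<phi> \<theta> \<xi>)" "\<lambda>\<xi>. - (\<xi> * x)"]
      by (simp add: mult.commute)
    have F: "fourier (\<phi> 0) x + \<i> * fourier (\<phi> (- pi / 2)) x = of_real (sqrt (2 * pi * s) * exp (- s * (x - b)\<^sup>2 / 2))" for x
    proof -
      have "fourier (\<phi> 0) x + \<i> * fourier (\<phi> (- pi / 2)) x =
          (LINT \<xi>|lborel. complex_of_real (\<phi> 0 \<xi>) * cis (- (\<xi> * x)) + \<i> * (complex_of_real (\<phi> (- pi / 2) \<xi>) * cis (- (\<xi> * x))))"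
        unfolding fourier_def using i[of 0 x] i[of "- pi / 2" x] by simp
      also have "\<dots> = (LINT \<xi>|lborel. cis ((b - x) * \<xi>) * ?G \<xi>)"
      proof (intro Bochner_Integration.integral_cong refl)
        fix \<xi>
        have "cos (b * \<xi> + - pi / 2) = sin (b * \<xi>)" by (simp add: cos_diff)
        then have "complex_of_real (\<phi> 0 \<xi>) + \<i> * complex_of_real (\<phi> (- pi / 2) \<xi>) = cis (b * \<xi>) * ?G \<xi>"
          by (simp add: \<phi>_def cis.ctr complex_eq_iff del: of_real_exp exp_of_real)
        moreover have "cis (b * \<xi>) * cis (- (\<xi> * x)) = cis ((b - x) * \<xi>)" by (simp add: cis_mult algebra_simps)
        moreover have "A * z + \<i> * (B * z) = y * G" if "A + \<i> * B = c * G" "c * z = y" for A B G c y z :: complex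
          using that by (metis distrib_right mult.assoc mult.commute)
        ultimately show "complex_of_real (\<phi> 0 \<xi>) * cis (- (\<xi> * x)) + \<i> * (complex_of_real (\<phi> (- pi / 2) \<xi>) * cis (- (\<xi> * x)))
          = cis ((b - x) * \<xi>) * ?G \<xi>"
          by blast
      qed
      also have "\<dots> = of_real (sqrt (2 * pi * s) * exp (- s * (x - b)\<^sup>2 / 2))"
        unfolding integral_cis_gauss[OF s'] by (simp add: power2_commute[of b] mult.commute)
      finally show ?thesis .
    qed
    have eq: "exp (- s * (x - b)\<^sup>2 / 2) *\<^sub>R d x = (1 / of_real (sqrt (2 * pi * s))) * (d x * fourier (\<phi> 0) x + \<i> * (d x * fourier (\<phi> (- pi / 2)) x))" for x
    proof -
      fix x
      have "d x * fourier (\<phi> 0) x + \<i> * (d x * fourier (\<phi> (- pi / 2)) x) = d x * (fourier (\<phi> 0) x + \<i> * fourier (\<phi> (- pi / 2)) x)"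
        by (simp add: algebra_simps)
      also have "\<dots> = d x * of_real (sqrt (2 * pi * s) * exp (- s * (x - b)\<^sup>2 / 2))"
        by (simp only: F)
      finally show "exp (- s * (x - b)\<^sup>2 / 2) *\<^sub>R d x = (1 / of_real (sqrt (2 * pi * s))) * (d x * fourier (\<phi> 0) x + \<i> * (d x * fourier (\<phi> (- pi / 2)) x))"
        using s by (simp add: scaleR_conv_of_real del: of_real_exp exp_of_real)
    qed
    show "integrable lborel (\<lambda>x. exp (- s * (x - b)\<^sup>2 / 2) *\<^sub>R d x)"
      "(LINT x|lborel. exp (- s * (x - b)\<^sup>2 / 2) *\<^sub>R d x) = 0"
      unfolding eq using d[OF \<phi>] by auto
  qed
  have "isCont d b" unfolding d_def[abs_def]
    by (intro continuous_intros cont isCont_inv_ft g)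
  then have "((\<lambda>s. sqrt s *\<^sub>R (LINT x|lborel. exp (- s * (x - b)\<^sup>2 / 2) *\<^sub>R d x)) \<longlongrightarrow> sqrt (2 * pi) *\<^sub>R d b) at_top"
    using G(1)[of 1] by (intro gauss_approx_identity) auto
  then have "((\<lambda>s::real. 0::complex) \<longlongrightarrow> sqrt (2 * pi) *\<^sub>R d b) at_top"
    by (rule Lim_transform_eventually) (use eventually_gt_at_top[of 0] in eventually_elim, simp add: G(2)[simplified])
  then have "sqrt (2 * pi) *\<^sub>R d b = 0"
    by (metis tendsto_const tendsto_unique trivial_limit_at_top_linorder)
  then show ?thesis by (simp add: d_def)
qed

text \<open>\<open>tempered_FT\<close> speaks only of products of \<open>g\<close> with test
  functions; a Gaussian test function has no zeros and can be divided out.\<close>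

lemma tempered_FT_measurable:
  assumes "tempered_FT p g" shows "g \<in> borel_measurable borel"
proof -
  define \<phi> where "\<phi> x = x ^ 0 * cos (0 * x + 0) * exp (- 1 * x\<^sup>2 / 2)" for x :: real
  have "schwartz \<phi>"
    unfolding \<phi>_def[abs_def] by (rule schwartz_gauss_trig[OF gauss_trig.monomial]) simp
  then have [measurable]: "(\<lambda>\<xi>. \<phi> \<xi> *\<^sub>R g \<xi>) \<in> borel_measurable borel" "\<phi> \<in> borel_measurable borel"
    using assms borel_measurable_integrable schwartz_measurable unfolding tempered_FT_def by auto
  have "(\<lambda>\<xi>. inverse (\<phi> \<xi>) *\<^sub>R (\<phi> \<xi> *\<^sub>R g \<xi>)) \<in> borel_measurable borel" by measurable
  then show ?thesis by (simp add: \<phi>_def)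
qed

section \<open>Continuity of the Schwarzian\<close>

lemma C_inf_nth_DERIV: "C_inf f \<Longrightarrow> ((deriv ^^ n) f has_real_derivative (deriv ^^ (Suc n)) f x) (at x)"
  by (simp add: C_inf_def DERIV_deriv_iff_real_differentiable)

text \<open>The inverse \<open>Y\<close> of \<open>X\<close> solves the autonomous equation \<open>Y' = r(Y)\<close> with \<open>r = 1 / \<surd>q\<close>.\<close>
lemma isCont_schwarzian_inv:
  fixes q X :: "real \<Rightarrow> real"
  assumes q: "C_inf q" "\<And>u. q u > 0"
    and X: "\<And>t. X t = (LBINT u=0..t. sqrt (q u))" and onto: "surj X"
  shows "isCont (schwarzian (inv X)) x"
proof -
  define Y where "Y = inv X"
  define q1 where "q1 = deriv q"
  define q2 where "q2 = deriv q1"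
  have dq: "(q has_real_derivative q1 u) (at u)" "(q1 has_real_derivative q2 u) (at u)" for u
    using C_inf_nth_DERIV[OF q(1), of 0 u] C_inf_nth_DERIV[OF q(1), of 1 u]
    by (simp_all add: q1_def q2_def)
  have cq: "isCont q u" "isCont q1 u" "isCont q2 u" for u
    using dq C_inf_nth_DERIV[OF q(1), of 2 u] DERIV_isCont by (auto simp: q1_def q2_def numeral_2_eq_2 intro: DERIV_isCont)
  have dX: "(X has_real_derivative sqrt (q t)) (at t)" for t
  proof -
    \<comment> \<open>The interval contains 0 and has \<open>t\<close> in its interior, so the
      derivative within it is a two-sided one.\<close>
    let ?a = "- \<bar>t\<bar> - 1" and ?b = "\<bar>t\<bar> + 1"
    have "((\<lambda>u. LBINT y=0..u. sqrt (q y)) has_vector_derivative sqrt (q t)) (at t within {?a..?b})"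
    proof -
      have "continuous_on {?a..?b} (\<lambda>y. sqrt (q y))"
        using cq(1) by (intro continuous_at_imp_continuous_on ballI continuous_intros) auto
      then show ?thesis
        using interval_integral_FTC2[of ?a 0 ?b "\<lambda>y. sqrt (q y)" t] by (simp add: zero_ereal_def)
    qed
    moreover have "at t within {?a..?b} = at t" by (rule at_within_Icc_at) auto
    ultimately show ?thesis
      using X by (simp add: has_real_derivative_iff_has_vector_derivative X[abs_def])
  qed
  have mono: "strict_mono X"
  proof (rule strict_monoI)
    fix s t :: real assume "s < t"
    then show "X s < X t" by (rule DERIV_pos_imp_increasing) (use dX q(2) real_sqrt_gt_zero in blast)
  qed
  then have inj: "inj X" by (rule strict_mono_imp_inj_on)
  have XY: "X (Y x) = x" "Y (X t) = t" for x t
    using onto inj by (simp_all add: Y_def surj_f_inv_f)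
  have cY: "isCont Y x" for x
  proof -
    have "isCont Y (X (Y x))"
      by (rule isCont_inverse_function[where d=1 and f=X and g=Y]) (use XY dX in \<open>auto intro: DERIV_isCont\<close>)
    then show ?thesis by (simp add: XY)
  qed
  have dY: "(Y has_real_derivative 1 / sqrt (q (Y x))) (at x)" for x
    using DERIV_inverse_function[where f=X and g=Y and x=x and D="sqrt (q (Y x))" and a="x - 1" and b="x + 1"] dX[of "Y x"] cY[of x] XY q(2)[of "Y x"]
    by (simp add: inverse_eq_divide)
  \<comment> \<open>Successive derivatives of \<open>Y\<close>, each written through
    \<open>q\<close> and its derivatives at \<open>Y\<close>: from \<open>Y' = 1 / sqrt q\<close>
    the square roots cancel and \<open>Y'' = - q' / (2 * q^2)\<close>. Continuity of the Schwarzian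
    is then visible from these expressions and \<open>Y1 \<noteq> 0\<close>.\<close>
  define Y1 where "Y1 x = 1 / sqrt (q (Y x))" for x
  define Y2 where "Y2 x = - q1 (Y x) / (2 * (q (Y x))\<^sup>2)" for x
  define Y3 where "Y3 x = - (q2 (Y x) * Y1 x * (2 * (q (Y x))\<^sup>2) - q1 (Y x) * (4 * q (Y x) * q1 (Y x) * Y1 x)) / (2 * (q (Y x))\<^sup>2)\<^sup>2" for x
  have dqY: "((\<lambda>x. q (Y x)) has_real_derivative q1 (Y x) * Y1 x) (at x)"
     "((\<lambda>x. q1 (Y x)) has_real_derivative q2 (Y x) * Y1 x) (at x)" for x
    using DERIV_chain2[OF dq(1) dY] DERIV_chain2[OF dq(2) dY] by (simp_all add: Y1_def)
  have nz: "q (Y x) \<noteq> 0" "q (Y x) > 0" for x using q(2)[of "Y x"] by auto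
  have dY1: "(Y1 has_real_derivative Y2 x) (at x)" for x
  proof -
    define s where "s = sqrt (q (Y x))"
    have s: "s > 0" "q (Y x) = s\<^sup>2" using nz(2)[of x] by (auto simp: s_def)
    have "((\<lambda>x. 1 / sqrt (q (Y x))) has_real_derivative (0 * sqrt (q (Y x)) - 1 * ((inverse (sqrt (q (Y x))) / 2) * (q1 (Y x) * Y1 x))) / (sqrt (q (Y x)) * sqrt (q (Y x)))) (at x)"
      using nz by (intro DERIV_divide DERIV_const DERIV_chain2[OF DERIV_real_sqrt dqY(1)]) auto
    moreover have "(0 * sqrt (q (Y x)) - 1 * ((inverse (sqrt (q (Y x))) / 2) * (q1 (Y x) * Y1 x))) / (sqrt (q (Y x)) * sqrt (q (Y x))) = Y2 x"
      unfolding Y2_def Y1_def s_def[symmetric] s(2) using s(1) by (simp add: field_simps power2_eq_square)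
    ultimately show ?thesis by (simp add: Y1_def[abs_def])
  qed
  have dY2: "(Y2 has_real_derivative Y3 x) (at x)" for x
    unfolding Y2_def[abs_def] Y3_def
    by (rule derivative_eq_intros dqY refl)+ (use nz(1)[of x] in \<open>simp_all add: power2_eq_square algebra_simps\<close>)
  have D: "deriv Y = Y1" "deriv Y1 = Y2" "deriv Y2 = Y3"
    using dY dY1 dY2 by (auto intro!: DERIV_imp_deriv simp: Y1_def)
  have S: "schwarzian Y = (\<lambda>x. Y3 x / Y1 x - 3 / 2 * (Y2 x / Y1 x) ^ 2)"
    by (simp add: schwarzian_def[abs_def] numeral_3_eq_3 numeral_2_eq_2 D)
  have cY': "isCont Y1 x" "isCont Y2 x" using dY1 dY2 DERIV_isCont by blast+
  have "isCont (\<lambda>x. q (Y x)) x" "isCont (\<lambda>x. q1 (Y x)) x" "isCont (\<lambda>x. q2 (Y x)) x"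
    by (rule isCont_o2[OF cY cq(1)] isCont_o2[OF cY cq(2)] isCont_o2[OF cY cq(3)])+
  then have "isCont Y3 x" unfolding Y3_def[abs_def] using nz(1)[of x] cY'(1) by (intro continuous_intros) auto
  moreover have "Y1 x \<noteq> 0" using nz(2)[of x] by (simp add: Y1_def)
  ultimately show ?thesis
    using cY' unfolding Y_def[symmetric] S by (intro continuous_intros) auto
qed

section \<open>The band-limited fixed point\<close>

text \<open>Convolution has no unit among functions, so the index is shifted:
  \<open>conv_power u n\<close> has \<open>n + 1\<close> factors and corresponds to
  \<open>inv_ft u ^ Suc n\<close>.\<close>

fun conv_power :: "(real \<Rightarrow> complex) \<Rightarrow> nat \<Rightarrow> real \<Rightarrow> complex" where
  "conv_power u 0 = u"
| "conv_power u (Suc n) = conv (conv_power u n) u"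

text \<open>The symmetry of the transform of a real function.\<close>

definition hermitian :: "(real \<Rightarrow> complex) \<Rightarrow> bool" where
  "hermitian u \<longleftrightarrow> (\<forall>\<xi>. u (- \<xi>) = cnj (u \<xi>))"

lemma inv_ft_hermitian: "hermitian u \<Longrightarrow> inv_ft u x = of_real (Re (inv_ft u x))"
proof -
  assume "hermitian u"
  then have "(\<lambda>\<xi>. cnj (u (- \<xi>))) = u" by (simp add: hermitian_def)
  then have "cnj (inv_ft u x) = inv_ft u x" using cnj_inv_ft[of u x] by simp
  then show ?thesis by (simp add: complex_eq_iff)
qed

lemma hermitian_conv: "hermitian u \<Longrightarrow> hermitian v \<Longrightarrow> hermitian (conv u v)"
proof -
  assume uv: "hermitian u" "hermitian v"
  have "conv u v (- \<xi>) = cnj (conv u v \<xi>)" for \<xi>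
  proof -
    have "(LINT \<eta>|lborel. u (- \<xi> - \<eta>) * v \<eta>) = (LINT \<eta>|lborel. u (- (\<xi> - \<eta>)) * v (- \<eta>))"
      by (subst lborel_integral_real_affine[where c="-1" and t=0]) (auto simp: algebra_simps)
    also have "\<dots> = (LINT \<eta>|lborel. cnj (u (\<xi> - \<eta>) * v \<eta>))"
      using uv unfolding hermitian_def by (simp only: complex_cnj_mult)
    also have "\<dots> = cnj (LINT \<eta>|lborel. u (\<xi> - \<eta>) * v \<eta>)"
      by (rule Bochner_Integration.integral_cnj)
    finally show ?thesis by (simp add: conv_def)
  qed
  then show ?thesis by (simp add: hermitian_def)
qed

lemma hermitian_conv_power: "hermitian u \<Longrightarrow> hermitian (conv_power u n)"
  by (induction n) (auto intro: hermitian_conv)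

lemma hermitian_suminf:
  assumes "\<And>n::nat. hermitian (u n)" "\<And>\<xi>. summable (\<lambda>n. u n \<xi>)"
  shows "hermitian (\<lambda>\<xi>. \<Sum>n. u n \<xi>)"
  using assms bounded_linear.suminf[OF bounded_linear_cnj assms(2)] by (simp add: hermitian_def)

lemma conv_zero_right [simp]: "conv u (\<lambda>\<xi>. 0) = (\<lambda>\<xi>. 0)"
  by (simp add: conv_def[abs_def])

lemma conv_power_zero [simp]: "conv_power (\<lambda>\<xi>. 0) n = (\<lambda>\<xi>. 0)"
  by (induction n) auto

lemma conv_power_measurable: "u \<in> borel_measurable borel \<Longrightarrow> conv_power u n \<in> borel_measurable borel"
  by (induction n) (auto intro: conv_measurable)

section \<open>Estimates in the weighted norm\<close>

locale band_limit =
  fixes lam \<Gamma> a :: real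
  assumes lam_pos: "lam > 0" and \<Gamma>_pos: "\<Gamma> > 0" and a_pos: "a > 0" and \<Gamma>_le: "6 * \<Gamma> \<le> lam"
begin

definition decays :: "real \<Rightarrow> (real \<Rightarrow> complex) \<Rightarrow> bool" where
  "decays B u \<longleftrightarrow> (\<forall>\<xi>. norm (u \<xi>) \<le> B * exp (- a * \<bar>\<xi>\<bar>))"

text \<open>Measurability is included so that the class can be passed directly to the convolution
  and integrability lemmas.\<close>

definition band_limited :: "(real \<Rightarrow> complex) \<Rightarrow> bool" where
  "band_limited u \<longleftrightarrow> u \<in> borel_measurable borel \<and> (\<forall>\<xi>. \<bar>\<xi>\<bar> > lam \<longrightarrow> u \<xi> = 0)"

definition "\<kappa> = lam / pi"

lemma \<kappa>_pos: "\<kappa> > 0" using lam_pos by (simp add: \<kappa>_def)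

lemma decaysD: "decays B u \<Longrightarrow> norm (u \<xi>) \<le> B * exp (- a * \<bar>\<xi>\<bar>)"
  by (simp add: decays_def)

lemma decays_nonneg: "decays B u \<Longrightarrow> B \<ge> 0"
  using order_trans[OF norm_ge_zero decaysD[of B u 0]] by simp

lemma decays_mono: "decays A u \<Longrightarrow> A \<le> B \<Longrightarrow> decays B u"
  unfolding decays_def by (meson exp_ge_zero mult_right_mono order_trans)

lemma decays_add: "decays A u \<Longrightarrow> decays B v \<Longrightarrow> decays (A + B) (\<lambda>\<xi>. u \<xi> + v \<xi>)"
  unfolding decays_def by (simp add: distrib_right norm_triangle_mono)

lemma decays_diff: "decays A u \<Longrightarrow> decays B v \<Longrightarrow> decays (A + B) (\<lambda>\<xi>. u \<xi> - v \<xi>)"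
  unfolding decays_def by (auto simp: distrib_right intro!: order_trans[OF norm_triangle_ineq4] add_mono)

lemma decays_cmult: "decays A u \<Longrightarrow> decays (norm c * A) (\<lambda>\<xi>. c * u \<xi>)"
  unfolding decays_def by (auto simp: norm_mult mult.assoc intro!: mult_left_mono)

lemma decays_integrable: "u \<in> borel_measurable borel \<Longrightarrow> decays B u \<Longrightarrow> integrable lborel u"
  using integrable_bound_exp_abs[OF a_pos] decaysD by blast

lemma decays_integrable_moment: "u \<in> borel_measurable borel \<Longrightarrow> decays B u \<Longrightarrow> integrable lborel (\<lambda>\<xi>. of_real \<xi> ^ n * u \<xi>)"
  using integrable_moment_exp_abs[OF a_pos] decaysD by blast

lemma decays_conv:
  assumes "decays A u" "decays B v" "band_limited v"
  shows "decays (\<kappa> * A * B) (conv u v)"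
  using norm_conv_le[of a lam A u v B] assms decays_nonneg[OF assms(1)] a_pos lam_pos
  unfolding decays_def band_limited_def \<kappa>_def by auto

text \<open>A bounded function times an integrable one. Needed at every point, not just almost
  everywhere, to split convolutions of differences.\<close>

lemma conv_integrand:
  assumes u: "u \<in> borel_measurable borel" "decays A u" and v: "v \<in> borel_measurable borel" "decays B v"
  shows "integrable lborel (\<lambda>\<eta>. u (\<xi> - \<eta>) * v \<eta>)"
proof (rule Bochner_Integration.integrable_bound)
  show "integrable lborel (\<lambda>\<eta>. A * norm (v \<eta>))" using decays_integrable[OF v] by auto
  note [measurable] = u(1) v(1)
  show "(\<lambda>\<eta>. u (\<xi> - \<eta>) * v \<eta>) \<in> borel_measurable lborel" by measurable
  have "norm (u \<eta>) \<le> A" for \<eta>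
    by (rule order_trans[OF decaysD[OF u(2)]]) (use decays_nonneg[OF u(2)] a_pos in \<open>simp add: mult_left_le\<close>)
  then show "AE \<eta> in lborel. norm (u (\<xi> - \<eta>) * v \<eta>) \<le> norm (A * norm (v \<eta>))"
    using decays_nonneg[OF u(2)] by (auto simp: norm_mult intro!: mult_right_mono)
qed

text \<open>The product rule \<open>u v - u' v' = (u - u') v + u' (v - v')\<close>, arranged so that
  the right factor is band limited in both terms.\<close>

lemma decays_conv_diff:
  assumes u: "u \<in> borel_measurable borel" "decays A0 u" and u': "u' \<in> borel_measurable borel" "decays A u'"
    and v: "band_limited v" "decays B v" and v': "band_limited v'" "decays B0 v'"
    and D: "decays D1 (\<lambda>\<xi>. u \<xi> - u' \<xi>)" "decays D2 (\<lambda>\<xi>. v \<xi> - v' \<xi>)"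
  shows "decays (\<kappa> * (D1 * B + A * D2)) (\<lambda>\<xi>. conv u v \<xi> - conv u' v' \<xi>)"
proof -
  have m: "v \<in> borel_measurable borel" "v' \<in> borel_measurable borel" using v(1) v'(1) by (auto simp: band_limited_def)
  have band_limited: "band_limited (\<lambda>\<xi>. v \<xi> - v' \<xi>)" using v(1) v'(1) by (auto simp: band_limited_def)
  have eq: "conv u v \<xi> - conv u' v' \<xi> = conv (\<lambda>\<xi>. u \<xi> - u' \<xi>) v \<xi> + conv u' (\<lambda>\<xi>. v \<xi> - v' \<xi>) \<xi>" for \<xi>
    using conv_integrand[OF u m(1) v(2), of \<xi>] conv_integrand[OF u' m(1) v(2), of \<xi>] conv_integrand[OF u' m(2) v'(2), of \<xi>]
    by (simp add: conv_def left_diff_distrib right_diff_distrib diff_divide_distrib)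
  show ?thesis
    unfolding eq using decays_add[OF decays_conv[OF D(1) v(2,1)] decays_conv[OF u'(2) D(2) band_limited]] by (simp add: algebra_simps)
qed

lemma decays_conv_power:
  assumes "band_limited u" "decays B u"
  shows "decays (\<kappa> ^ n * B ^ Suc n) (conv_power u n)"
proof (induction n)
  case 0 then show ?case using assms by simp
next
  case (Suc n) show ?case using decays_conv[OF Suc assms(2,1)] by (simp add: mult_ac)
qed

text \<open>Of the \<open>n + 1\<close> factors one at a time is exchanged, the others being bounded
  by \<open>B\<close>; each of the \<open>n\<close> convolutions costs
  \<open>\<kappa>\<close>.\<close>

lemma decays_conv_power_diff:
  assumes u: "band_limited u" "decays B u" and v: "band_limited v" "decays B v" and D: "decays D (\<lambda>\<xi>. u \<xi> - v \<xi>)"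
  shows "decays (real (Suc n) * (\<kappa> * B) ^ n * D) (\<lambda>\<xi>. conv_power u n \<xi> - conv_power v n \<xi>)"
proof (induction n)
  case 0 then show ?case using D by simp
next
  case (Suc n)
  have m: "conv_power u n \<in> borel_measurable borel" "conv_power v n \<in> borel_measurable borel"
    using u v by (auto intro: conv_power_measurable simp: band_limited_def)
  have "decays (\<kappa> * (real (Suc n) * (\<kappa> * B) ^ n * D * B + \<kappa> ^ n * B ^ Suc n * D)) (\<lambda>\<xi>. conv (conv_power u n) u \<xi> - conv (conv_power v n) v \<xi>)"
    by (rule decays_conv_diff[OF m(1) decays_conv_power[OF u] m(2) decays_conv_power[OF v] u v Suc D])
  also have "\<kappa> * (real (Suc n) * (\<kappa> * B) ^ n * D * B + \<kappa> ^ n * B ^ Suc n * D) = real (Suc (Suc n)) * (\<kappa> * B) ^ Suc n * D"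
    by (simp add: power_mult_distrib algebra_simps)
  finally show ?case by simp
qed

section \<open>The convolution exponential\<close>

text \<open>The transform of \<open>exp f - 1 - f\<close> when \<open>u\<close> is that of
  \<open>f\<close>. The series starts with the second power, so term \<open>n\<close> stands for the
  power \<open>n + 2\<close>, which is \<open>conv_power u (Suc n)\<close>.\<close>

definition conv_exp :: "(real \<Rightarrow> complex) \<Rightarrow> real \<Rightarrow> complex" where
  "conv_exp u \<xi> = (\<Sum>n. conv_power u (Suc n) \<xi> / fact (n + 2))"

lemma conv_exp_term_le:
  assumes "band_limited u" "decays B u"
  shows "norm (conv_power u (Suc n) \<xi> / fact (n + 2)) \<le> B * (\<kappa> * B) ^ Suc n * exp (- a * \<bar>\<xi>\<bar>)"
proof -
  have "norm (conv_power u (Suc n) \<xi> / fact (n + 2)) \<le> norm (conv_power u (Suc n) \<xi>)"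
  proof -
    have "norm (conv_power u (Suc n) \<xi> / fact (n + 2)) = norm (conv_power u (Suc n) \<xi>) / fact (n + 2)"
      by (simp only: norm_divide norm_fact)
    also have "\<dots> \<le> norm (conv_power u (Suc n) \<xi>) / 1"
      by (intro divide_left_mono fact_ge_1) auto
    finally show ?thesis by simp
  qed
  also have "\<dots> \<le> (\<kappa> ^ Suc n * B ^ Suc (Suc n)) * exp (- a * \<bar>\<xi>\<bar>)"
    by (rule decaysD[OF decays_conv_power[OF assms]])
  also have "\<dots> = B * (\<kappa> * B) ^ Suc n * exp (- a * \<bar>\<xi>\<bar>)" by (simp add: power_mult_distrib mult_ac)
  finally show ?thesis .
qed

lemma summable_conv_exp:
  assumes u: "band_limited u" "decays B u" and \<theta>: "\<kappa> * B < 1"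
  shows "summable (\<lambda>n. norm (conv_power u (Suc n) \<xi> / fact (n + 2)))"
proof (rule summable_comparison_test'[where N=0])
  have "\<kappa> * B \<ge> 0" using decays_nonneg[OF u(2)] \<kappa>_pos by simp
  then have "summable (\<lambda>n. (\<kappa> * B) ^ n)" using \<theta> by (intro summable_geometric) auto
  then have "summable (\<lambda>n. (\<kappa> * B) ^ Suc n)" by (subst summable_Suc_iff)
  then show "summable (\<lambda>n. B * (\<kappa> * B) ^ Suc n * exp (- a * \<bar>\<xi>\<bar>))"
    by (intro summable_mult summable_mult2)
  show "norm (norm (conv_power u (Suc n) \<xi> / fact (n + 2))) \<le> B * (\<kappa> * B) ^ Suc n * exp (- a * \<bar>\<xi>\<bar>)" for n
    using conv_exp_term_le[OF u] by simp
qed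

text \<open>The number \<open>n + 2\<close> of exchanged factors is cancelled by
  \<open>fact (n + 2)\<close>. A geometric series with ratio \<open>\<kappa> * B\<close> remains,
  starting at its first power, and \<open>\<kappa> * B \<le> 1 / 2\<close> bounds its sum by twice
  the first term.\<close>

lemma decays_conv_exp_diff:
  assumes u: "band_limited u" "decays B u" and v: "band_limited v" "decays B v" and D: "decays D (\<lambda>\<xi>. u \<xi> - v \<xi>)" and \<theta>: "\<kappa> * B \<le> 1 / 2"
  shows "decays (2 * (\<kappa> * B) * D) (\<lambda>\<xi>. conv_exp u \<xi> - conv_exp v \<xi>)"
  unfolding decays_def
proof
  fix \<xi>
  let ?\<theta> = "\<kappa> * B"
  have \<theta>0: "?\<theta> \<ge> 0" using decays_nonneg[OF u(2)] \<kappa>_pos by simp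
  have D0: "D \<ge> 0" by (rule decays_nonneg[OF D])
  have s: "summable (\<lambda>n. conv_power u (Suc n) \<xi> / fact (n + 2))" "summable (\<lambda>n. conv_power v (Suc n) \<xi> / fact (n + 2))"
    using \<theta> by (intro summable_norm_cancel[OF summable_conv_exp[OF u]] summable_norm_cancel[OF summable_conv_exp[OF v]]; simp)+
  have eq: "conv_exp u \<xi> - conv_exp v \<xi> = (\<Sum>n. conv_power u (Suc n) \<xi> / fact (n + 2) - conv_power v (Suc n) \<xi> / fact (n + 2))"
    unfolding conv_exp_def by (rule suminf_diff[OF s])
  have g: "(\<lambda>n. (D * exp (- a * \<bar>\<xi>\<bar>) * ?\<theta>) * ?\<theta> ^ n) sums ((D * exp (- a * \<bar>\<xi>\<bar>) * ?\<theta>) * (1 / (1 - ?\<theta>)))"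
    using \<theta> \<theta>0 by (intro sums_mult geometric_sums) auto
  have "norm (conv_exp u \<xi> - conv_exp v \<xi>) \<le> (\<Sum>n. (D * exp (- a * \<bar>\<xi>\<bar>) * ?\<theta>) * ?\<theta> ^ n)"
    unfolding eq
  proof (rule norm_suminf_le[OF _ sums_summable[OF g]])
    fix n
    have "norm (conv_power u (Suc n) \<xi> / fact (n + 2) - conv_power v (Suc n) \<xi> / fact (n + 2))
      = norm (conv_power u (Suc n) \<xi> - conv_power v (Suc n) \<xi>) / fact (n + 2)"
      by (simp only: norm_divide norm_fact diff_divide_distrib[symmetric])
    also have "\<dots> \<le> (real (Suc (Suc n)) * ?\<theta> ^ Suc n * D * exp (- a * \<bar>\<xi>\<bar>)) / fact (n + 2)"
      by (intro divide_right_mono decaysD[OF decays_conv_power_diff[OF u v D]]) simp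
    also have "\<dots> = (?\<theta> ^ Suc n * D * exp (- a * \<bar>\<xi>\<bar>)) * (real (Suc (Suc n)) / fact (n + 2))" by simp
    also have "\<dots> \<le> (?\<theta> ^ Suc n * D * exp (- a * \<bar>\<xi>\<bar>)) * 1"
    proof (rule mult_left_mono)
      have "real (n + 2) \<le> real (fact (n + 2))" by (intro of_nat_mono fact_ge_self)
      then have "real (Suc (Suc n)) \<le> fact (n + 2)" by (simp only: of_nat_fact Suc_eq_plus1 add.assoc one_add_one)
      then show "real (Suc (Suc n)) / fact (n + 2) \<le> 1" by (simp only: divide_le_eq_1 fact_gt_zero) simp
    qed (use \<theta>0 D0 in simp)
    finally show "norm (conv_power u (Suc n) \<xi> / fact (n + 2) - conv_power v (Suc n) \<xi> / fact (n + 2)) \<le> (D * exp (- a * \<bar>\<xi>\<bar>) * ?\<theta>) * ?\<theta> ^ n"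
      by (simp add: mult_ac)
  qed
  also have "\<dots> = (D * exp (- a * \<bar>\<xi>\<bar>) * ?\<theta>) * (1 / (1 - ?\<theta>))" by (rule sums_unique[OF g, symmetric])
  also have "\<dots> \<le> (D * exp (- a * \<bar>\<xi>\<bar>) * ?\<theta>) * 2"
    using \<theta> \<theta>0 D0 by (intro mult_left_mono) (simp_all add: divide_le_eq)
  finally show "norm (conv_exp u \<xi> - conv_exp v \<xi>) \<le> 2 * ?\<theta> * D * exp (- a * \<bar>\<xi>\<bar>)"
    by (simp add: mult_ac)
qed

lemma inv_ft_conv_power:
  assumes "band_limited u" "decays B u" shows "inv_ft (conv_power u n) x = inv_ft u x ^ Suc n"
proof (induction n)
  case (Suc n)
  have m: "u \<in> borel_measurable borel" using assms(1) by (simp add: band_limited_def)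
  show ?case
    using inv_ft_conv[OF decays_integrable[OF conv_power_measurable[OF m] decays_conv_power[OF assms]] decays_integrable[OF m assms(2)]] Suc
    by simp
qed simp

text \<open>The norms of the terms have integrals bounded by a geometric series, so summation and
  integration commute, and each convolution power becomes an ordinary power.\<close>

lemma inv_ft_conv_exp:
  assumes u: "band_limited u" "decays B u" and \<theta>: "\<kappa> * B < 1"
  shows "inv_ft (conv_exp u) x = exp (inv_ft u x) - 1 - inv_ft u x"
proof -
  have m: "u \<in> borel_measurable borel" using u(1) by (simp add: band_limited_def)
  let ?t = "\<lambda>n \<xi>. conv_power u (Suc n) \<xi> / fact (n + 2)"
  have it: "integrable lborel (?t n)" for n
    using decays_integrable[OF conv_power_measurable[OF m] decays_conv_power[OF u], of "Suc n"] by (intro integrable_divide_zero) auto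
  have "(LINT \<xi>|lborel. (\<Sum>n. cis (x * \<xi>) * ?t n \<xi>)) = (\<Sum>n. (LINT \<xi>|lborel. cis (x * \<xi>) * ?t n \<xi>))"
  proof (rule integral_suminf)
    show "integrable lborel (\<lambda>\<xi>. cis (x * \<xi>) * ?t n \<xi>)" for n
      using it by (intro integrable_cis_mult) auto
    show "AE \<xi> in lborel. summable (\<lambda>n. norm (cis (x * \<xi>) * ?t n \<xi>))"
      using summable_conv_exp[OF u \<theta>] by (simp only: norm_mult norm_cis mult_1) simp
    show "summable (\<lambda>n. LINT \<xi>|lborel. norm (cis (x * \<xi>) * ?t n \<xi>))"
    proof (rule summable_comparison_test'[where N=0])
      have "\<kappa> * B \<ge> 0" using decays_nonneg[OF u(2)] \<kappa>_pos by simp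
      then have "summable (\<lambda>n. (\<kappa> * B) ^ n)" using \<theta> by (intro summable_geometric) auto
      then have "summable (\<lambda>n. (\<kappa> * B) ^ Suc n)" by (subst summable_Suc_iff)
      then show "summable (\<lambda>n. B * (\<kappa> * B) ^ Suc n * (2 / a))"
        by (intro summable_mult summable_mult2)
      fix n
      have hb: "has_bochner_integral lborel (\<lambda>\<xi>. B * (\<kappa> * B) ^ Suc n * exp (- a * \<bar>\<xi>\<bar>)) (B * (\<kappa> * B) ^ Suc n * (2 / a))"
        by (intro has_bochner_integral_mult_right has_bochner_integral_exp_abs a_pos)
      have "(LINT \<xi>|lborel. norm (cis (x * \<xi>) * ?t n \<xi>)) \<le> (LINT \<xi>|lborel. B * (\<kappa> * B) ^ Suc n * exp (- a * \<bar>\<xi>\<bar>))"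
      proof (rule integral_mono')
        show "integrable lborel (\<lambda>\<xi>. B * (\<kappa> * B) ^ Suc n * exp (- a * \<bar>\<xi>\<bar>))" using hb by (simp only: has_bochner_integral_iff)
        show le: "norm (cis (x * \<xi>) * ?t n \<xi>) \<le> B * (\<kappa> * B) ^ Suc n * exp (- a * \<bar>\<xi>\<bar>)" for \<xi>
          using conv_exp_term_le[OF u] by (simp only: norm_mult norm_cis mult_1)
        show "0 \<le> B * (\<kappa> * B) ^ Suc n * exp (- a * \<bar>\<xi>\<bar>)" for \<xi> by (rule order_trans[OF norm_ge_zero le])
      qed
      also have "\<dots> = B * (\<kappa> * B) ^ Suc n * (2 / a)" using hb by (simp only: has_bochner_integral_iff)
      finally show "norm (LINT \<xi>|lborel. norm (cis (x * \<xi>) * ?t n \<xi>)) \<le> B * (\<kappa> * B) ^ Suc n * (2 / a)"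
        by (simp del: conv_power.simps)
    qed
  qed
  also have "(\<lambda>\<xi>. (\<Sum>n. cis (x * \<xi>) * ?t n \<xi>)) = (\<lambda>\<xi>. cis (x * \<xi>) * conv_exp u \<xi>)"
    unfolding conv_exp_def by (rule ext) (rule suminf_mult[OF summable_norm_cancel[OF summable_conv_exp[OF u \<theta>]]])
  finally have "inv_ft (conv_exp u) x = (\<Sum>n. (LINT \<xi>|lborel. cis (x * \<xi>) * ?t n \<xi>)) / of_real (2 * pi)"
    unfolding inv_ft_def by (rule arg_cong)
  also have "(\<lambda>n. (LINT \<xi>|lborel. cis (x * \<xi>) * ?t n \<xi>)) = (\<lambda>n. of_real (2 * pi) * (inverse (fact (n + 2)) *\<^sub>R inv_ft u x ^ (n + 2)))"
  proof
    fix n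
    have "(LINT \<xi>|lborel. cis (x * \<xi>) * ?t n \<xi>) = of_real (2 * pi) * inv_ft (conv_power u (Suc n)) x / fact (n + 2)"
      by (simp add: inv_ft_def del: conv_power.simps)
    then show "(LINT \<xi>|lborel. cis (x * \<xi>) * ?t n \<xi>) = of_real (2 * pi) * (inverse (fact (n + 2)) *\<^sub>R inv_ft u x ^ (n + 2))"
      unfolding inv_ft_conv_power[OF u] by (simp add: scaleR_conv_of_real divide_inverse mult_ac)
  qed
  also have "(\<Sum>n. of_real (2 * pi) * (inverse (fact (n + 2)) *\<^sub>R inv_ft u x ^ (n + 2))) = of_real (2 * pi) * (\<Sum>n. (inverse (fact (n + 2)) *\<^sub>R inv_ft u x ^ (n + 2)))"
    using summable_iff_shift[THEN iffD2, OF summable_exp_generic[of "inv_ft u x"], of 2]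
    by (intro suminf_mult) (simp add: divideR_right scaleR_conv_of_real)
  also have "(\<Sum>n. (inverse (fact (n + 2)) *\<^sub>R inv_ft u x ^ (n + 2))) = exp (inv_ft u x) - 1 - inv_ft u x"
    using exp_first_two_terms[of "inv_ft u x"] by simp
  finally show ?thesis by simp
qed

section \<open>The nonlinear operator on the Fourier side\<close>

definition mult_T :: "(real \<Rightarrow> complex) \<Rightarrow> real \<Rightarrow> complex" where
  "mult_T h \<xi> = h \<xi> / complex_of_real (4 * lam\<^sup>2 - \<xi>\<^sup>2)"

definition mult_DT :: "(real \<Rightarrow> complex) \<Rightarrow> real \<Rightarrow> complex" where
  "mult_DT h \<xi> = \<i> * of_real \<xi> * mult_T h \<xi>"

text \<open>The map \<open>W\<close> of the overview: \<open>mult_T h\<close> and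
  \<open>mult_DT h\<close> are the transforms of \<open>T \<sigma>\<close> and of its
  derivative.\<close>

definition nonlin :: "(real \<Rightarrow> complex) \<Rightarrow> real \<Rightarrow> complex" where
  "nonlin h \<xi> = (1 / 4) * conv (mult_DT h) (mult_DT h) \<xi> - of_real (4 * lam\<^sup>2) * conv_exp (mult_T h) \<xi>"

lemma band_limited_mult_T: "band_limited h \<Longrightarrow> band_limited (mult_T h)"
  unfolding band_limited_def mult_T_def[abs_def] by auto

lemma band_limited_mult_DT: "band_limited h \<Longrightarrow> band_limited (mult_DT h)"
  using band_limited_mult_T[of h] unfolding band_limited_def mult_DT_def[abs_def] by auto

text \<open>On the band \<open>\<xi>^2 \<le> lam^2\<close>, so the denominator is at least
  \<open>3 * lam^2\<close>; this is where the cut at \<open>lam\<close> pays.\<close>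

lemma decays_mult_T:
  assumes "band_limited h" "decays B h" shows "decays (B / (3 * lam\<^sup>2)) (mult_T h)"
  unfolding decays_def
proof
  fix \<xi>
  show "norm (mult_T h \<xi>) \<le> B / (3 * lam\<^sup>2) * exp (- a * \<bar>\<xi>\<bar>)"
  proof (cases "\<bar>\<xi>\<bar> \<le> lam")
    case True
    then have "\<xi>\<^sup>2 \<le> lam\<^sup>2" using lam_pos by (intro abs_le_square_iff[THEN iffD1]) auto
    then have l: "3 * lam\<^sup>2 \<le> 4 * lam\<^sup>2 - \<xi>\<^sup>2" by simp
    have p: "0 < 3 * lam\<^sup>2" using lam_pos by simp
    have "norm (mult_T h \<xi>) = norm (h \<xi>) / (4 * lam\<^sup>2 - \<xi>\<^sup>2)"
      unfolding mult_T_def norm_divide norm_of_real using l p by (simp only: abs_of_pos[OF less_le_trans[OF p l]])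
    also have "\<dots> \<le> (B * exp (- a * \<bar>\<xi>\<bar>)) / (3 * lam\<^sup>2)"
      by (intro frac_le order_trans[OF norm_ge_zero decaysD[OF assms(2)]] decaysD[OF assms(2)] l p)
    finally show ?thesis by simp
  next
    case False
    then have "mult_T h \<xi> = 0" using assms(1) by (simp add: band_limited_def mult_T_def)
    then show ?thesis using decays_nonneg[OF assms(2)] by simp
  qed
qed

lemma decays_mult_DT:
  assumes "band_limited h" "decays B h" shows "decays (B / (3 * lam)) (mult_DT h)"
  unfolding decays_def
proof
  fix \<xi>
  show "norm (mult_DT h \<xi>) \<le> B / (3 * lam) * exp (- a * \<bar>\<xi>\<bar>)"
  proof (cases "\<bar>\<xi>\<bar> \<le> lam")
    case True
    have "norm (mult_DT h \<xi>) \<le> lam * (B / (3 * lam\<^sup>2) * exp (- a * \<bar>\<xi>\<bar>))"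
      unfolding mult_DT_def norm_mult using True lam_pos by (intro mult_mono decaysD decays_mult_T assms) auto
    also have "\<dots> = B / (3 * lam) * exp (- a * \<bar>\<xi>\<bar>)"
      using lam_pos by (simp add: power2_eq_square)
    finally show ?thesis .
  next
    case False
    then have "mult_DT h \<xi> = 0" using assms(1) by (simp add: band_limited_def mult_DT_def mult_T_def)
    then show ?thesis using decays_nonneg[OF assms(2)] lam_pos by simp
  qed
qed

lemma mult_T_diff: "mult_T h \<xi> - mult_T k \<xi> = mult_T (\<lambda>\<xi>. h \<xi> - k \<xi>) \<xi>"
  by (simp add: mult_T_def diff_divide_distrib)

lemma mult_DT_diff: "mult_DT h \<xi> - mult_DT k \<xi> = mult_DT (\<lambda>\<xi>. h \<xi> - k \<xi>) \<xi>"
  by (simp add: mult_DT_def mult_T_diff[symmetric] right_diff_distrib)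

lemma band_limited_diff: "band_limited h \<Longrightarrow> band_limited k \<Longrightarrow> band_limited (\<lambda>\<xi>. h \<xi> - k \<xi>)"
  by (auto simp: band_limited_def)

text \<open>This is the ratio of the geometric series for \<open>conv_exp (mult_T h)\<close> on the
  ball of radius \<open>2 * \<Gamma>\<close>. It equals
  \<open>2 * \<Gamma> / (3 * pi * lam)\<close>, and \<open>2 * \<Gamma> \<le> lam\<close> together
  with \<open>pi > 3\<close> gives 1/9.\<close>

lemma \<kappa>_small: "\<kappa> * (2 * \<Gamma> / (3 * lam\<^sup>2)) \<le> 1 / 9"
proof -
  have "\<kappa> * (2 * \<Gamma> / (3 * lam\<^sup>2)) = (2 * \<Gamma>) / (3 * pi * lam)"
    using lam_pos by (simp add: \<kappa>_def power2_eq_square)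
  also have "\<dots> \<le> lam / (3 * pi * lam)"
    using \<Gamma>_le \<Gamma>_pos lam_pos by (intro divide_right_mono) auto
  also have "\<dots> = 1 / (3 * pi)" using lam_pos by simp
  also have "\<dots> \<le> 1 / (3 * 3)" using pi_gt3 by (intro divide_left_mono) auto
  finally show ?thesis by simp
qed

lemma measurable_nonlin: "h \<in> borel_measurable borel \<Longrightarrow> nonlin h \<in> borel_measurable borel"
proof -
  assume [measurable]: "h \<in> borel_measurable borel"
  have [measurable]: "mult_T h \<in> borel_measurable borel" "mult_DT h \<in> borel_measurable borel"
    unfolding mult_T_def[abs_def] mult_DT_def[abs_def] by measurable
  have [measurable]: "conv_power (mult_T h) n \<in> borel_measurable borel" "conv (mult_DT h) (mult_DT h) \<in> borel_measurable borel" for n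
    by (intro conv_power_measurable conv_measurable; measurable)+
  show ?thesis unfolding nonlin_def[abs_def] conv_exp_def[abs_def] by (simp del: conv_power.simps)
qed

text \<open>With \<open>\<theta>\<close> the ratio bounded in \<open>\<kappa>_small\<close>, the
  quadratic part contributes \<open>\<theta> * D / 6\<close> and the exponential part
  \<open>8 / 3 * \<theta> * D\<close>. For \<open>\<theta> \<le> 1 / 9\<close> the total is at most
  \<open>17 / 54 * D\<close>, below \<open>D / 2\<close>.\<close>

lemma decays_nonlin_diff:
  assumes h: "band_limited h" "decays (2 * \<Gamma>) h" and k: "band_limited k" "decays (2 * \<Gamma>) k" and D: "decays D (\<lambda>\<xi>. h \<xi> - k \<xi>)"
  shows "decays (D / 2) (\<lambda>\<xi>. nonlin h \<xi> - nonlin k \<xi>)"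
proof -
  define \<theta> where "\<theta> = \<kappa> * (2 * \<Gamma> / (3 * lam\<^sup>2))"
  have m: "mult_DT h \<in> borel_measurable borel" "mult_DT k \<in> borel_measurable borel"
    using band_limited_mult_DT h k by (auto simp: band_limited_def)
  have D1: "decays (D / (3 * lam)) (\<lambda>\<xi>. mult_DT h \<xi> - mult_DT k \<xi>)"
    unfolding mult_DT_diff by (rule decays_mult_DT[OF band_limited_diff[OF h(1) k(1)] D])
  have D2: "decays (D / (3 * lam\<^sup>2)) (\<lambda>\<xi>. mult_T h \<xi> - mult_T k \<xi>)"
    unfolding mult_T_diff by (rule decays_mult_T[OF band_limited_diff[OF h(1) k(1)] D])
  have 1: "decays (\<kappa> * (D / (3 * lam) * (2 * \<Gamma> / (3 * lam)) + 2 * \<Gamma> / (3 * lam) * (D / (3 * lam))))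
     (\<lambda>\<xi>. conv (mult_DT h) (mult_DT h) \<xi> - conv (mult_DT k) (mult_DT k) \<xi>)"
    by (rule decays_conv_diff[OF m(1) decays_mult_DT[OF h] m(2) decays_mult_DT[OF k] band_limited_mult_DT[OF h(1)] decays_mult_DT[OF h]
        band_limited_mult_DT[OF k(1)] decays_mult_DT[OF k] D1 D1])
  have 2: "decays (2 * \<theta> * (D / (3 * lam\<^sup>2))) (\<lambda>\<xi>. conv_exp (mult_T h) \<xi> - conv_exp (mult_T k) \<xi>)"
    unfolding \<theta>_def
    by (rule decays_conv_exp_diff[OF band_limited_mult_T[OF h(1)] decays_mult_T[OF h] band_limited_mult_T[OF k(1)] decays_mult_T[OF k] D2 order_trans[OF \<kappa>_small]]) simp
  have eq: "nonlin h \<xi> - nonlin k \<xi> = (1 / 4) * (conv (mult_DT h) (mult_DT h) \<xi> - conv (mult_DT k) (mult_DT k) \<xi>)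
     - of_real (4 * lam\<^sup>2) * (conv_exp (mult_T h) \<xi> - conv_exp (mult_T k) \<xi>)" for \<xi>
    by (simp add: nonlin_def algebra_simps diff_divide_distrib)
  have le: "norm (1 / 4 :: complex) * (\<kappa> * (D / (3 * lam) * (2 * \<Gamma> / (3 * lam)) + 2 * \<Gamma> / (3 * lam) * (D / (3 * lam))))
     + norm (of_real (4 * lam\<^sup>2) :: complex) * (2 * \<theta> * (D / (3 * lam\<^sup>2))) \<le> D / 2"
  proof -
    have A: "norm (1 / 4 :: complex) * (\<kappa> * (D / (3 * lam) * (2 * \<Gamma> / (3 * lam)) + 2 * \<Gamma> / (3 * lam) * (D / (3 * lam)))) = \<theta> * D / 6"
      using lam_pos by (simp add: \<theta>_def power2_eq_square norm_divide field_simps)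
    have B: "norm (of_real (4 * lam\<^sup>2) :: complex) * (2 * \<theta> * (D / (3 * lam\<^sup>2))) = 8 / 3 * (\<theta> * D)"
      using lam_pos unfolding norm_of_real by simp
    have "\<theta> * D \<le> 1 / 9 * D"
      using \<kappa>_small decays_nonneg[OF D] unfolding \<theta>_def by (rule mult_right_mono)
    then show ?thesis unfolding A B using decays_nonneg[OF D] by linarith
  qed
  show ?thesis unfolding eq by (rule decays_mono[OF decays_diff[OF decays_cmult[OF 1] decays_cmult[OF 2]] le])
qed

lemma nonlin_zero: "nonlin (\<lambda>\<xi>. 0) = (\<lambda>\<xi>. 0)"
proof -
  have "mult_T (\<lambda>\<xi>. 0) = (\<lambda>\<xi>. 0)" "mult_DT (\<lambda>\<xi>. 0) = (\<lambda>\<xi>. 0)" by (auto simp: mult_T_def mult_DT_def)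
  then show ?thesis by (simp add: nonlin_def[abs_def] conv_exp_def)
qed

text \<open>Contraction towards \<open>nonlin 0 = 0\<close> halves the radius
  \<open>2 * \<Gamma>\<close>. The other half is left for \<open>g\<close>, so the ball is mapped
  into itself.\<close>

lemma decays_nonlin:
  assumes h: "band_limited h" "decays (2 * \<Gamma>) h" shows "decays \<Gamma> (nonlin h)"
proof -
  have "band_limited (\<lambda>\<xi>. 0)" "decays (2 * \<Gamma>) (\<lambda>\<xi>. 0)" using \<Gamma>_pos by (auto simp: band_limited_def decays_def)
  from decays_nonlin_diff[OF h this, of "2 * \<Gamma>"] h show ?thesis by (simp add: nonlin_zero)
qed

lemma hermitian_nonlin:
  assumes h: "band_limited h" "decays (2 * \<Gamma>) h" "hermitian h" shows "hermitian (mult_T h)" "hermitian (mult_DT h)" "hermitian (nonlin h)"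
proof -
  show T: "hermitian (mult_T h)" and D: "hermitian (mult_DT h)"
    using h(3) by (auto simp: hermitian_def mult_T_def mult_DT_def)
  have f: "cnj (fact n) = fact n" for n by (metis complex_cnj_of_nat of_nat_fact)
  have "hermitian (\<lambda>\<xi>. conv_power (mult_T h) (Suc n) \<xi> / fact (n + 2))" for n
    using hermitian_conv_power[OF T, of "Suc n"] by (simp add: hermitian_def f del: conv_power.simps fact_Suc add_2_eq_Suc')
  then have "hermitian (conv_exp (mult_T h))"
    unfolding conv_exp_def[abs_def]
    by (rule hermitian_suminf)
       (rule summable_norm_cancel[OF summable_conv_exp[OF band_limited_mult_T[OF h(1)] decays_mult_T[OF h(1,2)] le_less_trans[OF \<kappa>_small]]], simp)
  with hermitian_conv[OF D D] show "hermitian (nonlin h)"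
    by (simp add: hermitian_def nonlin_def)
qed

lemma inv_ft_nonlin:
  assumes h: "band_limited h" "decays (2 * \<Gamma>) h"
  shows "inv_ft (nonlin h) x = (1 / 4) * (inv_ft (mult_DT h) x)\<^sup>2
     - of_real (4 * lam\<^sup>2) * (exp (inv_ft (mult_T h) x) - 1 - inv_ft (mult_T h) x)"
proof -
  let ?T = "mult_T h" and ?D = "mult_DT h"
  have m: "?T \<in> borel_measurable borel" "?D \<in> borel_measurable borel"
    using band_limited_mult_T band_limited_mult_DT h by (auto simp: band_limited_def)
  have dT: "decays (2 * \<Gamma> / (3 * lam\<^sup>2)) ?T" and dD: "decays (2 * \<Gamma> / (3 * lam)) ?D"
    using decays_mult_T decays_mult_DT h by auto
  have c: "conv_exp ?T \<in> borel_measurable borel"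
    unfolding conv_exp_def[abs_def] using conv_power_measurable[OF m(1)] by (simp del: conv_power.simps)
  have z: "band_limited (\<lambda>\<xi>. 0)" "decays (2 * \<Gamma> / (3 * lam\<^sup>2)) (\<lambda>\<xi>. 0)" using \<Gamma>_pos by (auto simp: band_limited_def decays_def)
  have i1: "integrable lborel (conv ?D ?D)"
    by (rule decays_integrable[OF conv_measurable[OF m(2) m(2)] decays_conv[OF dD dD band_limited_mult_DT[OF h(1)]]])
  \<comment> \<open>Decay of \<open>conv_exp ?T\<close> is obtained as its distance from
    \<open>conv_exp\<close> of the zero function, which vanishes.\<close>
  have "decays (2 * (\<kappa> * (2 * \<Gamma> / (3 * lam\<^sup>2))) * (2 * \<Gamma> / (3 * lam\<^sup>2))) (\<lambda>\<xi>. conv_exp ?T \<xi> - conv_exp (\<lambda>\<xi>. 0) \<xi>)"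
    by (rule decays_conv_exp_diff[OF band_limited_mult_T[OF h(1)] dT z _ order_trans[OF \<kappa>_small]]) (use dT in auto)
  then have i2: "integrable lborel (conv_exp ?T)"
    by (intro decays_integrable[OF c]) (simp add: conv_exp_def[of "\<lambda>\<xi>. 0"])
  have "inv_ft (nonlin h) x = (1 / 4) * inv_ft (conv ?D ?D) x - of_real (4 * lam\<^sup>2) * inv_ft (conv_exp ?T) x"
    unfolding nonlin_def[abs_def]
    by (subst inv_ft_diff) (use i1 i2 in \<open>auto simp only: inv_ft_cmult intro!: integrable_mult_right\<close>)
  also have "inv_ft (conv ?D ?D) x = (inv_ft ?D x)\<^sup>2"
    unfolding power2_eq_square by (rule inv_ft_conv) (rule decays_integrable[OF m(2) dD])+
  also have "inv_ft (conv_exp ?T) x = exp (inv_ft ?T x) - 1 - inv_ft ?T x"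
    by (rule inv_ft_conv_exp[OF band_limited_mult_T[OF h(1)] dT le_less_trans[OF \<kappa>_small]]) simp
  finally show ?thesis .
qed

lemma Top_eq: "Top lam h x = Re (inv_ft (mult_T h) x)"
  by (simp add: Top_def inv_ft_def mult_T_def)

text \<open>Hermitian symmetry makes both inverse transforms real, so taking real parts commutes
  with the square and the exponential.\<close>

lemma Sop_Top:
  assumes h: "band_limited h" "decays (2 * \<Gamma>) h" "hermitian h"
  shows "Sop lam (Top lam h) x = Re (inv_ft (nonlin h) x)"
proof -
  have m: "mult_T h \<in> borel_measurable borel" using band_limited_mult_T[OF h(1)] by (simp add: band_limited_def)
  have "Top lam h = (\<lambda>x. Re (inv_ft (mult_T h) x))" by (rule ext) (rule Top_eq)
  then have d: "deriv (Top lam h) x = Re (inv_ft (mult_DT h) x)"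
    using deriv_Re_inv_ft[OF decays_integrable_moment[OF m decays_mult_T[OF h(1,2)]]] by (simp add: mult_DT_def[abs_def])
  obtain r where r: "inv_ft (mult_T h) x = of_real r" "r = Re (inv_ft (mult_T h) x)"
    using inv_ft_hermitian[OF hermitian_nonlin(1)[OF h]] by blast
  obtain s where s: "inv_ft (mult_DT h) x = of_real s" "s = Re (inv_ft (mult_DT h) x)"
    using inv_ft_hermitian[OF hermitian_nonlin(2)[OF h]] by blast
  have "inv_ft (nonlin h) x = of_real ((1 / 4) * s\<^sup>2 - 4 * lam\<^sup>2 * (exp r - 1 - r))"
    unfolding inv_ft_nonlin[OF h(1,2)] r(1) s(1) by (simp add: exp_of_real)
  then show ?thesis unfolding Sop_def d Top_eq r(2)[symmetric] s(2)[symmetric] by simp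
qed

section \<open>Contraction iteration\<close>

text \<open>Banach's argument carried out pointwise in \<open>\<xi>\<close>: the weighted bounds
  make the iterates converge geometrically at every point, and measurability, support, the bound
  \<open>2 * \<Gamma>\<close> and Hermitian symmetry all survive pointwise limits.\<close>

lemma fixed_point:
  assumes g: "g \<in> borel_measurable borel" "decays \<Gamma> g" "hermitian g"
  obtains h where "band_limited h" "decays (2 * \<Gamma>) h" "hermitian h" "\<And>\<xi>. \<bar>\<xi>\<bar> \<le> lam \<Longrightarrow> h \<xi> = nonlin h \<xi> + g \<xi>"
proof -
  define \<Phi> where "\<Phi> h \<xi> = (if \<bar>\<xi>\<bar> \<le> lam then nonlin h \<xi> + g \<xi> else 0)" for h \<xi>
  define good where "good h \<longleftrightarrow> band_limited h \<and> decays (2 * \<Gamma>) h \<and> hermitian h" for h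
  define hs where "hs n = (\<Phi> ^^ n) (\<lambda>\<xi>. 0)" for n
  have hs_Suc: "hs (Suc n) = \<Phi> (hs n)" for n by (simp add: hs_def)
  have good_\<Phi>: "good (\<Phi> h)" if "good h" for h
  proof -
    have h: "band_limited h" "decays (2 * \<Gamma>) h" "hermitian h" using that by (auto simp: good_def)
    have [measurable]: "nonlin h \<in> borel_measurable borel" "g \<in> borel_measurable borel"
      using h measurable_nonlin g by (auto simp: band_limited_def)
    have "band_limited (\<Phi> h)" unfolding band_limited_def \<Phi>_def[abs_def] by auto
    moreover have "decays (\<Gamma> + \<Gamma>) (\<lambda>\<xi>. nonlin h \<xi> + g \<xi>)" by (rule decays_add[OF decays_nonlin[OF h(1,2)] g(2)])
    then have "decays (2 * \<Gamma>) (\<Phi> h)" unfolding decays_def \<Phi>_def using \<Gamma>_pos by auto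
    moreover have "hermitian (\<Phi> h)" using hermitian_nonlin(3)[OF h] g(3) by (auto simp: hermitian_def \<Phi>_def)
    ultimately show ?thesis by (simp add: good_def)
  qed
  have \<Phi>_diff: "decays (D / 2) (\<lambda>\<xi>. \<Phi> h \<xi> - \<Phi> k \<xi>)" if "good h" "good k" "decays D (\<lambda>\<xi>. h \<xi> - k \<xi>)" for h k D
    using decays_nonlin_diff[of h k D] decays_nonneg[OF that(3)] that by (auto simp: good_def decays_def \<Phi>_def)
  have good_hs: "good (hs n)" for n
  proof (induction n)
    case 0 show ?case using \<Gamma>_pos by (auto simp: hs_def good_def band_limited_def decays_def hermitian_def)
  qed (simp add: hs_Suc good_\<Phi>)
  \<comment> \<open>The iteration starts at 0, so the first increment is \<open>hs 1\<close> itself,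
    which lies in the ball; each application of \<open>\<Phi>\<close> halves the increment.\<close>
  have step: "decays (2 * \<Gamma> * (1 / 2) ^ n) (\<lambda>\<xi>. hs (Suc n) \<xi> - hs n \<xi>)" for n
  proof (induction n)
    case 0 show ?case using good_hs[of 1] by (simp add: hs_def good_def)
  next
    case (Suc n)
    from \<Phi>_diff[OF good_hs good_hs Suc] show ?case by (simp add: hs_Suc)
  qed
  define h where "h \<xi> = lim (\<lambda>n. hs n \<xi>)" for \<xi>
  have geo: "(\<lambda>k. 2 * \<Gamma> * (1 / 2) ^ (k + n) * exp (- a * \<bar>\<xi>\<bar>)) sums (4 * \<Gamma> * (1 / 2) ^ n * exp (- a * \<bar>\<xi>\<bar>))" for n \<xi>
    using sums_mult[OF geometric_sums[of "1 / 2 :: real"], of "2 * \<Gamma> * (1 / 2) ^ n * exp (- a * \<bar>\<xi>\<bar>)"]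
    by (simp add: power_add mult_ac)
  have lim: "(\<lambda>n. hs n \<xi>) \<longlonglongrightarrow> h \<xi>" for \<xi>
  proof -
    have "summable (\<lambda>n. hs (Suc n) \<xi> - hs n \<xi>)"
      by (rule summable_comparison_test'[OF sums_summable[OF geo[of 0 \<xi>]], of 0]) (use decaysD[OF step, of _ \<xi>] in simp)
    then have "convergent (\<lambda>n. \<Sum>k<n. hs (Suc k) \<xi> - hs k \<xi>)" by (simp add: summable_iff_convergent)
    moreover have "(\<Sum>k<n. hs (Suc k) \<xi> - hs k \<xi>) = hs n \<xi>" for n
      by (subst sum_lessThan_telescope) (simp add: hs_def)
    ultimately have "convergent (\<lambda>n. hs n \<xi>)" by simp
    then show ?thesis unfolding h_def by (rule convergent_LIMSEQ_iff[THEN iffD1])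
  qed
  have close: "decays (4 * \<Gamma> * (1 / 2) ^ n) (\<lambda>\<xi>. h \<xi> - hs n \<xi>)" for n
    unfolding decays_def
  proof
    fix \<xi>
    have "(\<lambda>k. hs (Suc k + n) \<xi> - hs (k + n) \<xi>) sums (h \<xi> - hs (0 + n) \<xi>)"
      by (rule telescope_sums) (rule LIMSEQ_ignore_initial_segment[OF lim])
    then have "h \<xi> - hs n \<xi> = (\<Sum>k. hs (Suc k + n) \<xi> - hs (k + n) \<xi>)" by (simp add: sums_iff)
    also have "norm \<dots> \<le> (\<Sum>k. 2 * \<Gamma> * (1 / 2) ^ (k + n) * exp (- a * \<bar>\<xi>\<bar>))"
      by (rule norm_suminf_le[OF _ sums_summable[OF geo]]) (use decaysD[OF step, of _ \<xi>] in simp)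
    also have "\<dots> = 4 * \<Gamma> * (1 / 2) ^ n * exp (- a * \<bar>\<xi>\<bar>)" by (rule sums_unique[OF geo, symmetric])
    finally show "norm (h \<xi> - hs n \<xi>) \<le> 4 * \<Gamma> * (1 / 2) ^ n * exp (- a * \<bar>\<xi>\<bar>)" .
  qed
  have gh: "good h"
  proof -
    have "h \<in> borel_measurable borel"
      by (rule borel_measurable_LIMSEQ_metric[OF _ lim]) (use good_hs in \<open>auto simp: good_def band_limited_def\<close>)
    moreover have "h \<xi> = 0" if "\<bar>\<xi>\<bar> > lam" for \<xi>
      by (rule LIMSEQ_unique[OF lim]) (use good_hs that in \<open>simp add: good_def band_limited_def\<close>)
    moreover have "norm (h \<xi>) \<le> 2 * \<Gamma> * exp (- a * \<bar>\<xi>\<bar>)" for \<xi>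
      by (rule LIMSEQ_le_const2[OF tendsto_norm[OF lim]]) (use good_hs in \<open>auto simp: good_def decays_def\<close>)
    moreover have "h (- \<xi>) = cnj (h \<xi>)" for \<xi>
    proof (rule LIMSEQ_unique[OF lim])
      have "(\<lambda>n. cnj (hs n \<xi>)) \<longlonglongrightarrow> cnj (h \<xi>)" by (intro tendsto_cnj lim)
      then show "(\<lambda>n. hs n (- \<xi>)) \<longlonglongrightarrow> cnj (h \<xi>)" using good_hs by (simp add: good_def hermitian_def)
    qed
    ultimately show ?thesis by (simp add: good_def band_limited_def decays_def hermitian_def)
  qed
  \<comment> \<open>The contraction estimate between \<open>h\<close> and \<open>hs n\<close> shows
    that \<open>hs (Suc n)\<close> also tends to \<open>\<Phi> h\<close>.\<close>
  have "\<Phi> h \<xi> = h \<xi>" for \<xi>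
  proof (rule LIMSEQ_unique[OF _ lim[THEN LIMSEQ_Suc]])
    have "(\<lambda>n. hs (Suc n) \<xi> - \<Phi> h \<xi>) \<longlonglongrightarrow> 0"
    proof (rule Lim_null_comparison[OF always_eventually[OF allI]])
      fix n
      show "norm (hs (Suc n) \<xi> - \<Phi> h \<xi>) \<le> 4 * \<Gamma> * (1 / 2) ^ n / 2 * exp (- a * \<bar>\<xi>\<bar>)"
        unfolding hs_Suc by (subst norm_minus_commute) (rule decaysD[OF \<Phi>_diff[OF gh good_hs close]])
      show "(\<lambda>n. 4 * \<Gamma> * (1 / 2) ^ n / 2 * exp (- a * \<bar>\<xi>\<bar>)) \<longlonglongrightarrow> 0"
        by real_asymp
    qed
    then show "(\<lambda>n. hs (Suc n) \<xi>) \<longlonglongrightarrow> \<Phi> h \<xi>" by (rule Lim_null[THEN iffD2])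
  qed
  then have "h \<xi> = nonlin h \<xi> + g \<xi>" if "\<bar>\<xi>\<bar> \<le> lam" for \<xi>
    using that by (metis \<Phi>_def)
  with gh that show thesis by (auto simp: good_def)
qed

end

section \<open>Symmetrisation and the error bound\<close>

text \<open>\<open>p\<close> determines its transform only up to null sets, so the given
  \<open>g\<close> can fail the symmetry at some points, whereas the iteration requires it
  everywhere. Averaging \<open>g\<close> with its reflected conjugate keeps the bound, and it keeps
  the inverse transform because \<open>p\<close> is real.\<close>

lemma hermitian_symmetrization:
  assumes "g \<in> borel_measurable borel" "\<And>\<xi>. norm (g \<xi>) \<le> \<Gamma> * exp (- a * \<bar>\<xi>\<bar>)" "a > 0"
    and real: "\<And>x. inv_ft g x = of_real (p x)"
  defines "g' \<equiv> \<lambda>\<xi>. (1 / 2) * (g \<xi> + cnj (g (- \<xi>)))"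
  shows "g' \<in> borel_measurable borel" "norm (g' \<xi>) \<le> \<Gamma> * exp (- a * \<bar>\<xi>\<bar>)" "hermitian g'" "inv_ft g' x = of_real (p x)"
proof -
  note [measurable] = assms(1)
  have cm: "(\<lambda>\<xi>. cnj (g (- \<xi>))) \<in> borel_measurable borel"
    by (rule borel_measurable_continuous_on[OF continuous_on_cnj[OF continuous_on_id]]) measurable
  show "g' \<in> borel_measurable borel" unfolding g'_def using cm by measurable
  have "norm (g \<xi> + cnj (g (- \<xi>))) \<le> \<Gamma> * exp (- a * \<bar>\<xi>\<bar>) + \<Gamma> * exp (- a * \<bar>\<xi>\<bar>)"
    using assms(2)[of \<xi>] assms(2)[of "- \<xi>"] by (intro norm_triangle_mono) auto
  then show "norm (g' \<xi>) \<le> \<Gamma> * exp (- a * \<bar>\<xi>\<bar>)" by (simp add: g'_def norm_mult)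
  show "hermitian g'" by (simp add: hermitian_def g'_def)
  have i: "integrable lborel g" by (rule integrable_bound_exp_abs[OF assms(3,1,2)])
  have ic: "integrable lborel (\<lambda>\<xi>. cnj (g (- \<xi>)))"
    by (rule integrable_bound_exp_abs[OF assms(3) cm, of \<Gamma>]) (use assms(2)[of "- _"] in simp)
  have "inv_ft g' x = (1 / 2) * (inv_ft g x + cnj (inv_ft g x))"
    unfolding g'_def inv_ft_cmult cnj_inv_ft by (simp only: inv_ft_add[OF i ic])
  then show "inv_ft g' x = of_real (p x)" by (simp add: real)
qed

theorem mainTheorem1:
  fixes q :: "real \<Rightarrow> real" and X :: "real \<Rightarrow> real" and p :: "real \<Rightarrow> real"
    and lam \<Gamma> a :: real
  assumes q_smooth: "C_inf q"
    and q_pos: "\<forall>u. q u > 0"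
    and X_def: "\<forall>t. X t = (LBINT u=0..t. sqrt (q u))"
    and X_onto: "surj X"
    and p_def: "\<forall>x. p x = 2 * schwarzian (inv X) x"
    and lam_pos: "lam > 0" and \<Gamma>_pos: "\<Gamma> > 0" and a_pos: "a > 0"
    and lam_big: "lam \<ge> 6 * max (1 / a) \<Gamma>"
    and p_FT: "\<exists>g. tempered_FT p g \<and> (\<forall>\<xi>. norm (g \<xi>) \<le> \<Gamma> * exp (- a * \<bar>\<xi>\<bar>))"
  shows "\<exists>p_b \<sigma>_b h.
     C_inf p_b \<and> C_inf \<sigma>_b \<and> integrable lborel (\<lambda>x. (\<sigma>_b x) ^ 2) \<and>
     tempered_FT \<sigma>_b h \<and> integrable lborel h \<and>
     (\<forall>\<xi>. \<bar>\<xi>\<bar> > sqrt 2 * lam \<longrightarrow> h \<xi> = 0) \<and>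
     (\<forall>x. \<sigma>_b x = Sop lam (Top lam h) x + p_b x) \<and>
     (\<forall>\<xi>. norm (h \<xi>) \<le> 2 * \<Gamma> * exp (- (5 / 6) * a * \<bar>\<xi>\<bar>)) \<and>
     (\<exists>C < 24 * \<Gamma> / (5 * a) * exp (- (5 / 6) * a * lam).
        AE x in lborel. \<bar>p x - p_b x\<bar> \<le> C)"
proof -
  obtain g0 where g0: "tempered_FT p g0" "\<And>\<xi>. norm (g0 \<xi>) \<le> \<Gamma> * exp (- a * \<bar>\<xi>\<bar>)"
    using p_FT by blast
  have g0m: "g0 \<in> borel_measurable borel" by (rule tempered_FT_measurable[OF g0(1)])
  have "p = (\<lambda>x. 2 * schwarzian (inv X) x)" using p_def by auto
  moreover have "isCont (schwarzian (inv X)) x" for x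
    by (rule isCont_schwarzian_inv[OF q_smooth q_pos[rule_format] X_def[rule_format] X_onto])
  ultimately have p_cont: "isCont p x" for x by auto
  have p_eq: "inv_ft g0 x = of_real (p x)" for x
    by (rule tempered_FT_inversion[OF g0(1) integrable_bound_exp_abs[OF a_pos g0m g0(2)] p_cont])
  obtain g where gm: "g \<in> borel_measurable borel" and g: "\<And>\<xi>. norm (g \<xi>) \<le> \<Gamma> * exp (- a * \<bar>\<xi>\<bar>)"
    and gh: "hermitian g" and gp: "\<And>x. inv_ft g x = of_real (p x)"
    using hermitian_symmetrization[OF g0m g0(2) a_pos p_eq] by blast
  interpret band_limit lam \<Gamma> a
    using lam_big max.cobounded2[of \<Gamma> "1 / a"] by unfold_locales (use lam_pos \<Gamma>_pos a_pos in auto)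
  have dg: "decays \<Gamma> g" using g by (simp add: decays_def)
  obtain h where h: "band_limited h" "decays (2 * \<Gamma>) h" "hermitian h" and fp: "\<And>\<xi>. \<bar>\<xi>\<bar> \<le> lam \<Longrightarrow> h \<xi> = nonlin h \<xi> + g \<xi>"
    using fixed_point[OF gm dg gh] by blast
  have hm: "h \<in> borel_measurable borel" using h(1) by (simp add: band_limited_def)
  note nm = measurable_nonlin[OF hm] and dn = decays_nonlin[OF h(1,2)]
  \<comment> \<open>The transform of \<open>p_b\<close>, defined on the whole line so that the
    equation for \<open>\<sigma>_b\<close> holds by construction. The fixed point property says that
    \<open>r\<close> agrees with \<open>g\<close> on the band.\<close>
  define r where "r \<xi> = h \<xi> - nonlin h \<xi>" for \<xi>
  have rm: "r \<in> borel_measurable borel" unfolding r_def[abs_def] using hm nm by measurable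
  have dr: "decays (2 * \<Gamma> + \<Gamma>) r" unfolding r_def[abs_def] by (rule decays_diff[OF h(2) dn])
  have ih: "integrable lborel h" by (rule decays_integrable[OF hm h(2)])
  have ir: "integrable lborel r" by (rule decays_integrable[OF rm dr])
  have ig: "integrable lborel g" by (rule decays_integrable[OF gm dg])
  have "Re (inv_ft r x) = Re (inv_ft h x) - Re (inv_ft (nonlin h) x)" for x
    unfolding r_def[abs_def] by (subst inv_ft_diff[OF ih decays_integrable[OF nm dn]]) simp
  then have eqn: "Re (inv_ft h x) = Sop lam (Top lam h) x + Re (inv_ft r x)" for x
    by (simp add: Sop_Top[OF h])
  have h_le: "norm (h \<xi>) \<le> 2 * \<Gamma>" for \<xi>
    by (rule order_trans[OF decaysD[OF h(2)]]) (use \<Gamma>_pos a_pos in simp)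
  have h_dec: "norm (h \<xi>) \<le> 2 * \<Gamma> * exp (- (5 / 6) * a * \<bar>\<xi>\<bar>)" for \<xi>
  proof (rule order_trans[OF decaysD[OF h(2)]])
    have "a * \<bar>\<xi>\<bar> \<ge> 0" using a_pos by simp
    then show "2 * \<Gamma> * exp (- a * \<bar>\<xi>\<bar>) \<le> 2 * \<Gamma> * exp (- (5 / 6) * a * \<bar>\<xi>\<bar>)" using \<Gamma>_pos by simp
  qed
  define K where "K = 2 * \<Gamma> * exp (- (5 / 6) * a * lam)"
  have K: "K > 0" using \<Gamma>_pos by (simp add: K_def)
  \<comment> \<open>Off the band \<open>h\<close> vanishes and \<open>g - r\<close> is
    \<open>g + nonlin h\<close>, two terms of size \<open>\<Gamma>\<close>. Five sixths of the
    exponent are evaluated at \<open>lam\<close> and form \<open>K\<close>; the remaining sixth is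
    kept for integration.\<close>
  have tail: "norm (g \<xi> - r \<xi>) \<le> K * exp (- (a / 6) * \<bar>\<xi>\<bar>)" for \<xi>
  proof (cases "\<bar>\<xi>\<bar> \<le> lam")
    case True then show ?thesis using fp K by (simp add: r_def)
  next
    case False
    then have "h \<xi> = 0" using h(1) by (simp add: band_limited_def)
    then have "norm (g \<xi> - r \<xi>) \<le> (\<Gamma> + \<Gamma>) * exp (- a * \<bar>\<xi>\<bar>)"
      using decaysD[OF decays_add[OF dg dn], of \<xi>] by (simp add: r_def)
    also have "\<dots> \<le> (\<Gamma> + \<Gamma>) * (exp (- (5 / 6) * a * lam) * exp (- (a / 6) * \<bar>\<xi>\<bar>))"
    proof (intro mult_left_mono)
      have "a * lam \<le> a * \<bar>\<xi>\<bar>" using False a_pos by (intro mult_left_mono) auto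
      then show "exp (- a * \<bar>\<xi>\<bar>) \<le> exp (- (5 / 6) * a * lam) * exp (- (a / 6) * \<bar>\<xi>\<bar>)"
        unfolding exp_add[symmetric] by simp
    qed (use \<Gamma>_pos in simp)
    finally show ?thesis by (simp add: K_def mult_ac)
  qed
  have hb: "has_bochner_integral lborel (\<lambda>\<xi>. K * exp (- (a / 6) * \<bar>\<xi>\<bar>)) (K * (2 / (a / 6)))"
    using a_pos by (intro has_bochner_integral_mult_right has_bochner_integral_exp_abs) auto
  have close: "\<bar>p x - Re (inv_ft r x)\<bar> \<le> 12 * \<Gamma> / (pi * a) * exp (- (5 / 6) * a * lam)" for x
  proof -
    have "inv_ft (\<lambda>\<xi>. g \<xi> - r \<xi>) x = of_real (p x) - inv_ft r x"
      by (simp add: inv_ft_diff[OF ig ir] gp)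
    then have "\<bar>p x - Re (inv_ft r x)\<bar> = \<bar>Re (inv_ft (\<lambda>\<xi>. g \<xi> - r \<xi>) x)\<bar>" by simp
    also have "\<dots> \<le> norm (inv_ft (\<lambda>\<xi>. g \<xi> - r \<xi>) x)" by (rule abs_Re_le_cmod)
    also have "\<dots> \<le> (LINT \<xi>|lborel. K * exp (- (a / 6) * \<bar>\<xi>\<bar>)) / (2 * pi)"
      by (rule norm_inv_ft_le) (use ig ir hb tail in \<open>auto simp: has_bochner_integral_iff\<close>)
    also have "(LINT \<xi>|lborel. K * exp (- (a / 6) * \<bar>\<xi>\<bar>)) = K * (2 / (a / 6))"
      using hb by (simp only: has_bochner_integral_iff)
    also have "K * (2 / (a / 6)) / (2 * pi) = 12 * \<Gamma> / (pi * a) * exp (- (5 / 6) * a * lam)"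
      by (simp add: K_def field_simps)
    finally show ?thesis .
  qed
  \<comment> \<open>The strict inequality is \<open>pi > 5 / 2\<close>, and it leaves room for the
    explicit constant as witness.\<close>
  have C: "12 * \<Gamma> / (pi * a) * exp (- (5 / 6) * a * lam) < 24 * \<Gamma> / (5 * a) * exp (- (5 / 6) * a * lam)"
  proof (rule mult_strict_right_mono)
    have "12 * \<Gamma> / (pi * a) = (12 / pi) * (\<Gamma> / a)" by simp
    also have "\<dots> < (24 / 5) * (\<Gamma> / a)"
      using pi_gt3 \<Gamma>_pos a_pos by (intro mult_strict_right_mono) (simp_all add: divide_less_eq)
    finally show "12 * \<Gamma> / (pi * a) < 24 * \<Gamma> / (5 * a)" by simp
  qed simp
  have h_supp: "h \<xi> = 0" if "\<bar>\<xi>\<bar> > sqrt 2 * lam" for \<xi>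
  proof -
    have "1 * lam \<le> sqrt 2 * lam" using lam_pos by (intro mult_right_mono) auto
    then show ?thesis using that h(1) by (simp add: band_limited_def)
  qed
  show ?thesis
  proof (rule exI[of _ "\<lambda>x. Re (inv_ft r x)"], rule exI[of _ "\<lambda>x. Re (inv_ft h x)"], rule exI[of _ h], intro conjI allI impI)
    show "C_inf (\<lambda>x. Re (inv_ft r x))" by (rule C_inf_Re_inv_ft[OF decays_integrable_moment[OF rm dr]])
    show "C_inf (\<lambda>x. Re (inv_ft h x))" by (rule C_inf_Re_inv_ft[OF decays_integrable_moment[OF hm h(2)]])
    show "integrable lborel (\<lambda>x. (Re (inv_ft h x))\<^sup>2)"
      by (rule integrable_inv_ft_square[OF ih h_le inv_ft_hermitian[OF h(3)]])
    show "tempered_FT (\<lambda>x. Re (inv_ft h x)) h"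
      by (rule tempered_FT_inv_ft[OF ih inv_ft_hermitian[OF h(3)]])
    show "\<exists>C<24 * \<Gamma> / (5 * a) * exp (- (5 / 6) * a * lam). AE x in lborel. \<bar>p x - Re (inv_ft r x)\<bar> \<le> C"
      by (rule exI[of _ "12 * \<Gamma> / (pi * a) * exp (- (5 / 6) * a * lam)"]) (intro conjI C AE_I2 close)
  qed (use ih h_supp eqn h_dec in auto)
qed

end
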